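(* Let $\mathbb{K}$ be an algebraically closed field, let $n\ge 1$, and let $F_n=\mathbb{K}\langle z_1,\ldots,z_n\rangle$ be the free associative unital $\mathbb{K}$-algebra on $n$ generators. Then any effective regular action $\sigma$ of the $n$-dimensional algebraic torus $\mathbb{T}_n$ on $F_n$ is linearizable.
   Context: $\mathbb{T}_r=(\mathbb{K}^\times)^r$ is the algebraic $r$-torus, with characters $\chi(t)=t_1^{\alpha_1}\cdots t_r^{\alpha_r}$, $\alpha\in\mathbb{Z}^r$. A regular action of $\mathbb{T}_r$ on a $\mathbb{K}$-algebra $F$ is a $\mathbb{K}$-algebra homomorphism $\sigma:F\to F\otimes\mathbb{K}[t_1^{\pm1},\ldots,t_r^{\pm1}]$, $\sigma(f)=\sum_\chi \chi(t)f_\chi$ (a finite sum), whose specializations $\sigma(t)$, $t\in\mathbb{T}_r$, satisfy the action axioms $\sigma(1)=\mathrm{id}$, $\sigma(s)\circ\sigma(t)=\sigma(st)$ (so each $\sigma(t)$ is an automorphism of $F$ and $F=\bigoplus_\chi F_\chi$ with $F_\chi=\{f:\sigma(f)=\chi(t)f\}$). The action is effective if $\sigma(t)\ne \mathrm{id}$ for every $t\neq 1$ in $\mathbb{T}_r$. An action on $F_n$ is linear if for all $t$ and $i$, $\sigma(t)(z_i)$ is a $\mathbb{K}$-linear combination of $z_1,\ldots,z_n$; it is linearizable if there is an automorphism $\beta$ of the $\mathbb{K}$-algebra $F_n$ such that $t\mapsto\beta^{-1}\circ\sigma(t)\circ\beta$ is linear. *)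

theory Defs
  imports
    "HOL-Library.Poly_Mapping"
    "HOL-Library.Function_Algebras"
    "HOL-Computational_Algebra.Polynomial"
begin

section \<open>Algebras over a field\<close>

locale assoc_algebra = vector_space scale
  for scale :: "'k::field \<Rightarrow> 'a::ring_1 \<Rightarrow> 'a" +
  assumes scale_mult_left: "scale c x * y = scale c (x * y)"
    and scale_mult_right: "x * scale c y = scale c (x * y)"

locale algebra_hom =
  A: assoc_algebra s1 + B: assoc_algebra s2 + Vector_Spaces.linear s1 s2 \<phi>
  for s1 :: "'k::field \<Rightarrow> 'a::ring_1 \<Rightarrow> 'a"
    and s2 :: "'k \<Rightarrow> 'b::ring_1 \<Rightarrow> 'b"
    and \<phi> :: "'a \<Rightarrow> 'b" +
  assumes hom_one: "\<phi> 1 = 1"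
    and hom_mult: "\<phi> (x * y) = \<phi> x * \<phi> y"

definition algebra_automorphism ::
  "('k::field \<Rightarrow> 'a::ring_1 \<Rightarrow> 'a) \<Rightarrow> ('a \<Rightarrow> 'a) \<Rightarrow> bool" where
  "algebra_automorphism s \<beta> \<longleftrightarrow> algebra_hom s s \<beta> \<and> bij \<beta>"

text \<open>
  For a monoid \<open>M\<close> (written additively) and a \<open>K\<close>-algebra \<open>F\<close> with scalar multiplication
  \<open>s\<close>, the ring \<open>M \<Rightarrow>\<^sub>0 F\<close> is the monoid algebra \<open>F[M]\<close>, that is, \<open>F\<close> tensored over \<open>K\<close>
  with \<open>K[M]\<close>. It is a \<open>K\<close>-algebra under coefficientwise scaling.
\<close>

definition coeff_scale :: "('k \<Rightarrow> 'a::zero \<Rightarrow> 'a) \<Rightarrow> 'k \<Rightarrow> ('m \<Rightarrow>\<^sub>0 'a) \<Rightarrow> ('m \<Rightarrow>\<^sub>0 'a)" where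
  "coeff_scale s c f = Poly_Mapping.map (s c) f"

lemma poly_mapping_monomial_induct [case_names single sum]:
  fixes P :: "('m \<Rightarrow>\<^sub>0 'a::monoid_add) \<Rightarrow> bool"
  assumes "\<And>k v. P (Poly_Mapping.single k v)"
    and "\<And>f g. P f \<Longrightarrow> P g \<Longrightarrow> P (f + g)"
  shows "P f"
proof (induction f rule: update_induct)
  case const
  show ?case using assms(1)[of undefined 0] by simp
next
  case (update f k v)
  have "Poly_Mapping.update k v f = f + Poly_Mapping.single k v"
    using update.hyps
    by (intro poly_mapping_eqI)
      (auto simp: lookup_update lookup_add lookup_single when_def in_keys_iff)
  with update.IH assms show ?case by simp
qed

lemma (in assoc_algebra) lookup_coeff_scale:
  "Poly_Mapping.lookup (coeff_scale scale c f) m = scale c (Poly_Mapping.lookup f m)"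
  by (auto simp: coeff_scale_def Poly_Mapping.map.rep_eq when_def)

lemma (in assoc_algebra) assoc_algebra_coeff_scale:
  "assoc_algebra (coeff_scale scale :: 'k \<Rightarrow> ('m::monoid_add \<Rightarrow>\<^sub>0 'a) \<Rightarrow> _)"
proof -
  define e :: "'k \<Rightarrow> 'm \<Rightarrow>\<^sub>0 'a" where "e c = Poly_Mapping.single 0 (scale c 1)" for c
  have l: "coeff_scale scale c x = e c * x" for c x
  proof (rule poly_mapping_eqI)
    fix m
    show "Poly_Mapping.lookup (coeff_scale scale c x) m = Poly_Mapping.lookup (e c * x) m"
    proof (induction x rule: poly_mapping_monomial_induct)
      case (single k v)
      then show ?case
        by (simp add: lookup_coeff_scale e_def mult_single scale_mult_left lookup_single when_def)
    next
      case (sum f g)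
      then show ?case
        by (simp add: lookup_coeff_scale lookup_add scale_right_distrib distrib_left)
    qed
  qed
  have r: "x * e c = e c * x" for c x
  proof (induction x rule: poly_mapping_monomial_induct)
    case (single k v)
    then show ?case by (simp add: e_def mult_single scale_mult_left scale_mult_right)
  next
    case (sum f g)
    then show ?case by (simp add: distrib_left distrib_right)
  qed
  have [simp]: "e (a + b) = e a + e b" "e (a * b) = e a * e b" "e 1 = 1" for a b
    by (simp_all add: e_def scale_left_distrib single_add mult_single scale_mult_left)
  show ?thesis
  proof
    show "coeff_scale scale c x * y = coeff_scale scale c (x * y)"
      for c and x y :: "'m \<Rightarrow>\<^sub>0 'a"
      by (simp add: l mult.assoc)
    show "x * coeff_scale scale c y = coeff_scale scale c (x * y)"
      for c and x y :: "'m \<Rightarrow>\<^sub>0 'a"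
      unfolding l by (metis r mult.assoc)
  qed (simp_all add: l distrib_left distrib_right mult.assoc)
qed


section \<open>The free associative algebra\<close>

instantiation list :: (type) monoid_add
begin

definition zero_list :: "'a list" where "zero_list = []"
definition plus_list :: "'a list \<Rightarrow> 'a list \<Rightarrow> 'a list" where "plus_list = (@)"

instance by standard (simp_all add: zero_list_def plus_list_def)

end

text \<open>
  The free algebra on generators indexed by \<open>'n\<close> is the monoid algebra of the free monoid
  \<open>'n list\<close>: its elements are finite linear combinations of words.
\<close>

type_synonym ('n, 'k) free_algebra = "'n list \<Rightarrow>\<^sub>0 'k"

abbreviation free_scale :: "'k::field \<Rightarrow> ('n, 'k) free_algebra \<Rightarrow> ('n, 'k) free_algebra" where
  "free_scale \<equiv> coeff_scale (*)"

definition gen :: "'n \<Rightarrow> ('n, 'k::field) free_algebra" where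
  "gen i = Poly_Mapping.single [i] 1"

global_interpretation free_algebra: assoc_algebra free_scale
proof (rule assoc_algebra.assoc_algebra_coeff_scale)
  show "assoc_algebra ((*) :: 'k::field \<Rightarrow> 'k \<Rightarrow> 'k)"
    by standard (simp_all add: algebra_simps)
qed


section \<open>Torus actions\<close>

text \<open>The torus of rank \<open>r = CARD('r)\<close>, under pointwise multiplication of functions.\<close>

definition torus :: "('r \<Rightarrow> 'k::field) set" where
  "torus = {t. \<forall>i. t i \<noteq> 0}"

definition torus_character :: "('r::finite \<Rightarrow> int) \<Rightarrow> ('r \<Rightarrow> 'k::field) \<Rightarrow> 'k" where
  "torus_character \<alpha> t = (\<Prod>i\<in>UNIV. t i powi \<alpha> i)"

text \<open>
  The tensor product of \<open>F\<close> with the Laurent polynomial ring in \<open>'r\<close>-indexed variables is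
  the monoid algebra of the exponent lattice \<open>'r \<Rightarrow> int\<close> over \<open>F\<close>; the coefficient of
  \<open>\<sigma> f\<close> at \<open>\<alpha>\<close> is the component of \<open>f\<close> for the character with exponent vector \<open>\<alpha>\<close>.
\<close>

type_synonym ('r, 'a) laurent = "('r \<Rightarrow> int) \<Rightarrow>\<^sub>0 'a"

definition specialize ::
  "('k::field \<Rightarrow> 'a::ring_1 \<Rightarrow> 'a) \<Rightarrow> ('a \<Rightarrow> ('r::finite, 'a) laurent) \<Rightarrow> ('r \<Rightarrow> 'k) \<Rightarrow> 'a \<Rightarrow> 'a" where
  "specialize s \<sigma> t f =
     (\<Sum>\<alpha>\<in>Poly_Mapping.keys (\<sigma> f). s (torus_character \<alpha> t) (Poly_Mapping.lookup (\<sigma> f) \<alpha>))"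

definition regular_action ::
  "('k::field \<Rightarrow> 'a::ring_1 \<Rightarrow> 'a) \<Rightarrow> ('a \<Rightarrow> ('r::finite, 'a) laurent) \<Rightarrow> bool" where
  "regular_action s \<sigma> \<longleftrightarrow>
     algebra_hom s (coeff_scale s) \<sigma> \<and>
     specialize s \<sigma> 1 = id \<and>
     (\<forall>t\<in>torus. \<forall>u\<in>torus. specialize s \<sigma> t \<circ> specialize s \<sigma> u = specialize s \<sigma> (t * u))"

definition effective ::
  "('k::field \<Rightarrow> 'a::ring_1 \<Rightarrow> 'a) \<Rightarrow> ('a \<Rightarrow> ('r::finite, 'a) laurent) \<Rightarrow> bool" where
  "effective s \<sigma> \<longleftrightarrow> (\<forall>t\<in>torus. t \<noteq> 1 \<longrightarrow> specialize s \<sigma> t \<noteq> id)"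

definition linear_family ::
  "(('r \<Rightarrow> 'k::field) \<Rightarrow> ('n, 'k) free_algebra \<Rightarrow> ('n, 'k) free_algebra) \<Rightarrow> bool" where
  "linear_family \<tau> \<longleftrightarrow> (\<forall>t\<in>torus. \<forall>i. \<tau> t (gen i) \<in> free_algebra.span (range gen))"

definition linearizable ::
  "(('n, 'k::field) free_algebra \<Rightarrow> ('r::finite, ('n, 'k) free_algebra) laurent) \<Rightarrow> bool" where
  "linearizable \<sigma> \<longleftrightarrow>
     (\<exists>\<beta>. algebra_automorphism free_scale \<beta> \<and>
          linear_family (\<lambda>t. inv \<beta> \<circ> specialize free_scale \<sigma> t \<circ> \<beta>))"

end

theory Submission
  imports Defs "HOL-Analysis.Cartesian_Space"
begin

text \<open>
  A torus action is a grading of the free algebra \<open>F\<close> by the exponent lattice. Let \<open>I\<close> be the ideal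
  of elements vanishing at every point \<open>F \<rightarrow> K\<close>. A torus element acting trivially modulo \<open>I\<close>, hence
  modulo the square of the augmentation ideal, acts unipotently and diagonalizably, hence trivially;
  so the weights of \<open>F/I\<close> contain \<open>n\<close> linearly independent ones. As \<open>F/I\<close> grows like a polynomial
  ring in \<open>n\<close> variables, its elements of weight \<open>0\<close> are constant. A product of elements of opposite
  nonzero weights is therefore \<open>0\<close> in \<open>F/I\<close>, since otherwise its factors would be units, and units
  are constant. Thus the value of the component of weight \<open>0\<close> is a point fixed by the torus.

  Move that point to the origin and choose homogeneous elements \<open>f\<^sub>1, \<dots>, f\<^sub>n\<close> of the augmentation ideal
  whose linear parts form a basis. Comparing lowest-degree terms, every weight of \<open>F\<close> is that of some
  word in the \<open>f\<^sub>i\<close>, so effectiveness makes the weights of the \<open>f\<^sub>i\<close> linearly independent. A weight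
  then determines the length of the word, which makes a homogeneous element equal to its leading
  term written in the \<open>f\<^sub>i\<close>. Hence \<open>z\<^sub>i \<mapsto> f\<^sub>i\<close> is an automorphism, and it linearizes the action.
\<close>

section \<open>Homomorphisms out of the free algebra\<close>

context algebra_hom
begin

lemma hom_power: "\<phi> (x ^ n) = \<phi> x ^ n"
  by (induction n) (simp_all add: hom_one hom_mult)

lemma hom_prod_list: "\<phi> (prod_list xs) = prod_list (map \<phi> xs)"
  by (induction xs) (simp_all add: hom_one hom_mult)

end

lemma algebra_homI:
  assumes "assoc_algebra s1" "assoc_algebra s2"
    and "\<And>x y. \<phi> (x + y) = \<phi> x + \<phi> y" "\<And>c x. \<phi> (s1 c x) = s2 c (\<phi> x)"
    and "\<phi> 1 = 1" "\<And>x y. \<phi> (x * y) = \<phi> x * \<phi> y"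
  shows "algebra_hom s1 s2 \<phi>"
proof -
  interpret A: assoc_algebra s1 by fact
  interpret B: assoc_algebra s2 by fact
  show ?thesis
    by unfold_locales (use assms in auto)
qed

lemma algebra_hom_comp:
  assumes "algebra_hom s1 s2 \<phi>" "algebra_hom s2 s3 \<psi>"
  shows "algebra_hom s1 s3 (\<psi> \<circ> \<phi>)"
proof -
  interpret f: algebra_hom s1 s2 \<phi> by fact
  interpret g: algebra_hom s2 s3 \<psi> by fact
  show ?thesis
    by (rule algebra_homI)
      (auto simp: f.A.assoc_algebra_axioms g.B.assoc_algebra_axioms f.add g.add f.scale g.scale
        f.hom_one g.hom_one f.hom_mult g.hom_mult)
qed

lemma (in assoc_algebra) algebra_hom_id: "algebra_hom scale scale id"
  by (rule algebra_homI) (simp_all add: assoc_algebra_axioms)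

global_interpretation field_algebra: assoc_algebra "(*) :: 'k::field \<Rightarrow> 'k \<Rightarrow> 'k"
  by standard (simp_all add: algebra_simps)

global_interpretation poly_algebra: assoc_algebra "smult :: 'k::field \<Rightarrow> 'k poly \<Rightarrow> 'k poly"
  by standard (simp_all add: smult_add_left smult_add_right)

lemma single_eq_scale_single: "Poly_Mapping.single w c = free_scale c (Poly_Mapping.single w 1)"
  by (rule poly_mapping_eqI) (simp add: field_algebra.lookup_coeff_scale lookup_single when_def)

lemma single_eq_prod_gen: "Poly_Mapping.single w 1 = prod_list (map gen w)"
proof (induction w)
  case Nil
  then show ?case by (metis list.simps(8) prod_list.Nil single_one zero_list_def)
next
  case (Cons i w)
  then show ?case
    by (simp only: list.map prod_list.Cons Cons.IH[symmetric])
      (simp add: gen_def mult_single plus_list_def)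
qed

lemma lookup_gen: "Poly_Mapping.lookup (gen i) w = (if w = [i] then 1 else 0)"
  by (simp add: gen_def lookup_single when_def)

lemma free_algebra_hom_eqI:
  assumes "algebra_hom free_scale s \<phi>" "algebra_hom free_scale s \<psi>"
    and "\<And>i. \<phi> (gen i) = \<psi> (gen i)"
  shows "\<phi> = \<psi>"
proof
  interpret f: algebra_hom free_scale s \<phi> by fact
  interpret g: algebra_hom free_scale s \<psi> by fact
  fix x
  show "\<phi> x = \<psi> x"
  proof (induction x rule: poly_mapping_monomial_induct)
    case (single w c)
    have "map (\<phi> \<circ> gen) w = map (\<psi> \<circ> gen) w" using assms(3) by simp
    then show ?case
      by (simp only: single_eq_scale_single[of w c] single_eq_prod_gen f.scale g.scale
          f.hom_prod_list g.hom_prod_list map_map)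
  qed (simp add: f.add g.add)
qed

text \<open>The homomorphism given by the universal property. Factors stay in word order because the
  target need not be commutative.\<close>

definition free_lift ::
  "('k::field \<Rightarrow> 'a::ring_1 \<Rightarrow> 'a) \<Rightarrow> ('n \<Rightarrow> 'a) \<Rightarrow> ('n, 'k) free_algebra \<Rightarrow> 'a" where
  "free_lift s a f =
     (\<Sum>w\<in>Poly_Mapping.keys f. s (Poly_Mapping.lookup f w) (prod_list (map a w)))"

context assoc_algebra
begin

lemma free_lift_superset:
  assumes "finite A" "Poly_Mapping.keys f \<subseteq> A"
  shows "free_lift scale a f = (\<Sum>w\<in>A. scale (Poly_Mapping.lookup f w) (prod_list (map a w)))"
  unfolding free_lift_def
  by (rule sum.mono_neutral_left) (use assms in \<open>auto simp: in_keys_iff\<close>)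

lemma free_lift_single: "free_lift scale a (Poly_Mapping.single w c) = scale c (prod_list (map a w))"
  by (subst free_lift_superset[of "{w}"]) (auto split: if_splits)

lemma free_lift_add: "free_lift scale a (f + g) = free_lift scale a f + free_lift scale a g"
proof -
  let ?A = "Poly_Mapping.keys f \<union> Poly_Mapping.keys g"
  have "Poly_Mapping.keys (f + g) \<subseteq> ?A" by (rule Poly_Mapping.keys_add)
  then show ?thesis
    by (simp add: free_lift_superset[of ?A] lookup_add scale_left_distrib sum.distrib)
qed

lemma free_lift_gen [simp]: "free_lift scale a (gen i) = a i"
  by (simp add: gen_def free_lift_single)

lemma algebra_hom_free_lift: "algebra_hom free_scale scale (free_lift scale a)"
proof (rule algebra_homI)
  show "free_lift scale a (free_scale c x) = scale c (free_lift scale a x)" for c x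
  proof -
    have "Poly_Mapping.keys (free_scale c x) \<subseteq> Poly_Mapping.keys x"
      by (auto simp: in_keys_iff field_algebra.lookup_coeff_scale)
    then show ?thesis
      by (simp add: free_lift_superset[of "Poly_Mapping.keys x"] field_algebra.lookup_coeff_scale
          scale_sum_right)
  qed
  have "free_lift scale a (Poly_Mapping.single 0 1) = 1"
    by (simp only: free_lift_single) (simp add: zero_list_def)
  then show "free_lift scale a 1 = 1" by simp
  show "free_lift scale a (x * y) = free_lift scale a x * free_lift scale a y" for x y
  proof (induction x rule: poly_mapping_monomial_induct)
    case (single v c)
    show ?case
    proof (induction y rule: poly_mapping_monomial_induct)
      case (single w d)
      then show ?case
        by (simp add: mult_single free_lift_single plus_list_def scale_mult_left scale_mult_right)
    qed (simp add: distrib_left free_lift_add)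
  qed (simp add: distrib_right free_lift_add)
qed (simp_all add: free_lift_add free_algebra.assoc_algebra_axioms assoc_algebra_axioms)

end

lemma lookup_free_scale [simp]:
  "Poly_Mapping.lookup (free_scale c f) w = c * Poly_Mapping.lookup f w"
  by (rule field_algebra.lookup_coeff_scale)

lemma free_algebra_expand:
  fixes f :: "('n, 'k::field) free_algebra"
  shows "f = (\<Sum>w\<in>Poly_Mapping.keys f. free_scale (Poly_Mapping.lookup f w) (prod_list (map gen w)))"
proof -
  have "free_lift free_scale gen = (id :: ('n, 'k) free_algebra \<Rightarrow> _)"
    by (rule free_algebra_hom_eqI[OF free_algebra.algebra_hom_free_lift free_algebra.algebra_hom_id])
      simp
  then have "f = free_lift free_scale gen f" by simp
  then show ?thesis by (simp only: free_lift_def)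
qed

lemma algebra_automorphism_inverse:
  assumes "algebra_hom s s \<phi>" "algebra_hom s s \<psi>" "\<phi> \<circ> \<psi> = id" "\<psi> \<circ> \<phi> = id"
  shows "algebra_automorphism s \<phi>"
  unfolding algebra_automorphism_def using assms o_bij by blast

section \<open>Points\<close>

definition ev :: "('n \<Rightarrow> 'k) \<Rightarrow> ('n, 'k::field) free_algebra \<Rightarrow> 'k" where
  "ev a = free_lift (*) a"

text \<open>The kernel of restriction to points. For infinite \<open>'k\<close> the quotient by it
  is a polynomial ring in commuting variables; here it is handled through values and restrictions to
  lines.\<close>

definition vanishing :: "('n, 'k::field) free_algebra \<Rightarrow> bool" where
  "vanishing f \<longleftrightarrow> (\<forall>a. ev a f = 0)"

text \<open>Restriction to the line through \<open>a\<close> and \<open>b\<close>, with parameter 0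
  at \<open>a\<close> and 1 at \<open>b\<close>. It reduces questions in several variables to
  polynomials in one variable.\<close>

definition line :: "('n \<Rightarrow> 'k) \<Rightarrow> ('n \<Rightarrow> 'k) \<Rightarrow> ('n, 'k::field) free_algebra \<Rightarrow> 'k poly" where
  "line a b = free_lift smult (\<lambda>i. [:a i, b i - a i:])"

interpretation ev: algebra_hom free_scale "(*)" "ev a"
  unfolding ev_def by (rule field_algebra.algebra_hom_free_lift)

interpretation line: algebra_hom free_scale smult "line a b"
  unfolding line_def by (rule poly_algebra.algebra_hom_free_lift)

lemma ev_gen [simp]: "ev a (gen i) = a i"
  by (simp add: ev_def)

lemma line_gen [simp]: "line a b (gen i) = [:a i, b i - a i:]"
  by (simp add: line_def)

text \<open>Used to recognise new points: a point composed with a torus element, and later the value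
  of the weight-zero component.\<close>

lemma algebra_hom_eq_ev:
  assumes "algebra_hom free_scale (*) \<phi>"
  shows "\<phi> = ev (\<lambda>i. \<phi> (gen i))"
  by (rule free_algebra_hom_eqI[OF assms ev.algebra_hom_axioms]) simp

lemma algebra_hom_poly: "algebra_hom smult (*) (\<lambda>p :: 'k::field poly. poly p s)"
  by (rule algebra_homI) (auto simp: poly_algebra.assoc_algebra_axioms field_algebra.assoc_algebra_axioms)

lemma poly_line: "poly (line a b f) s = ev (\<lambda>i. a i + s * (b i - a i)) f"
proof -
  have "(\<lambda>p. poly p s) \<circ> line a b = ev (\<lambda>i. a i + s * (b i - a i))"
    by (rule free_algebra_hom_eqI)
      (auto intro: algebra_hom_comp algebra_hom_poly line.algebra_hom_axioms ev.algebra_hom_axioms)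
  then show ?thesis by (metis comp_apply)
qed

lemma poly_line_0 [simp]: "poly (line a b f) 0 = ev a f"
  and poly_line_1 [simp]: "poly (line a b f) 1 = ev b f"
  by (simp_all add: poly_line)

lemma lookup_Nil_eq_ev: "Poly_Mapping.lookup f [] = ev (\<lambda>_. 0) f"
proof -
  have "ev (\<lambda>_. 0) f = (\<Sum>w\<in>insert [] (Poly_Mapping.keys f).
          Poly_Mapping.lookup f w * prod_list (map (\<lambda>_. 0) w))"
    unfolding ev_def by (rule field_algebra.free_lift_superset) auto
  also have "\<dots> = (\<Sum>w\<in>insert [] (Poly_Mapping.keys f). if w = [] then Poly_Mapping.lookup f [] else 0)"
    by (intro sum.cong refl) (auto simp: neq_Nil_conv)
  finally show ?thesis by simp
qed

text \<open>Over a finite field, one plus the product of all \<open>[:- a, 1:]\<close> is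
  nonconstant and has the value 1 everywhere, hence no root.\<close>

lemma infinite_UNIV_alg_closed: "infinite (UNIV :: 'k::alg_closed_field set)"
proof
  assume fin: "finite (UNIV :: 'k set)"
  let ?p = "1 + (\<Prod>a\<in>(UNIV :: 'k set). [:- a, 1:])"
  have "degree (\<Prod>a\<in>(UNIV :: 'k set). [:- a, 1:]) = card (UNIV :: 'k set)"
    using degree_prod_eq_sum_degree[of UNIV "\<lambda>a::'k. [:- a, 1:]"] by simp
  moreover have "card (UNIV :: 'k set) > 0" using fin by (simp add: card_gt_0_iff)
  ultimately have "degree ?p > 0" by (subst degree_add_eq_right) simp_all
  then obtain x where "poly ?p x = 0"
    using alg_closed_imp_poly_has_root by blast
  then have "1 + (\<Prod>a\<in>(UNIV :: 'k set). x - a) = 0" by (simp add: poly_prod)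
  moreover have "(\<Prod>a\<in>(UNIV :: 'k set). x - a) = 0"
    using fin by (intro prod_zero) auto
  ultimately show False by simp
qed

lemma line_eq_0:
  fixes f :: "('n, 'k::alg_closed_field) free_algebra"
  assumes "vanishing f"
  shows "line a b f = 0"
proof -
  have "{x. poly (line a b f) x = 0} = UNIV"
    using assms by (simp add: poly_line vanishing_def)
  then show ?thesis
    using poly_roots_finite[of "line a b f"] infinite_UNIV_alg_closed by metis
qed

text \<open>Restrict to the line joining a point where \<open>f\<close> is nonzero to one where
  \<open>g\<close> is nonzero: two nonzero polynomials in one variable have a nonzero
  product.\<close>

lemma vanishing_mult_cancel:
  fixes f g :: "('n, 'k::alg_closed_field) free_algebra"
  assumes "vanishing (f * g)"
  shows "vanishing f \<or> vanishing g"
proof (rule ccontr)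
  assume "\<not> ?thesis"
  then obtain a b where "ev a f \<noteq> 0" "ev b g \<noteq> 0" by (auto simp: vanishing_def)
  then have "line a b f \<noteq> 0" "line a b g \<noteq> 0"
    by (metis poly_line_0 poly_0, metis poly_line_1 poly_0)
  moreover have "line a b f * line a b g = 0"
    using line_eq_0[OF assms] by (simp add: line.hom_mult)
  ultimately show False by simp
qed

text \<open>On every line \<open>f\<close> becomes a divisor of a nonzero constant, hence a constant
  polynomial.\<close>

lemma ev_const_if_unit:
  fixes f g :: "('n, 'k::alg_closed_field) free_algebra"
  assumes "\<And>x. ev x (f * g) = c" "c \<noteq> 0"
  shows "ev a f = ev b f"
proof -
  have "vanishing (f * g - free_scale c 1)"
    using assms by (simp add: vanishing_def ev.diff ev.scale ev.hom_one)
  then have "line a b f * line a b g = [:c:]"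
    using line_eq_0[of "f * g - free_scale c 1" a b]
    by (simp add: line.diff line.scale line.hom_one line.hom_mult)
  then have "line a b f dvd [:c:]" by (metis dvd_triv_left)
  with \<open>c \<noteq> 0\<close> have "degree (line a b f) = 0"
    by (metis degree_pCons_0 dvd_imp_degree_le le_zero_eq pCons_eq_0_iff)
  then obtain d where "line a b f = [:d:]" by (rule degree_eq_zeroE)
  then show ?thesis using poly_line_0[of a b f] poly_line_1[of a b f] by simp
qed

text \<open>Already on the line through \<open>a\<close> and \<open>b\<close>, \<open>f\<close> is a
  nonconstant polynomial, and such a polynomial takes every value over an algebraically closed
  field.\<close>

lemma ev_surj_if_nonconst:
  fixes f :: "('n, 'k::alg_closed_field) free_algebra"
  assumes "ev a f \<noteq> ev b f"
  shows "\<exists>x. ev x f = y"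
proof -
  have "degree (line a b f - [:y:]) > 0"
  proof (rule ccontr)
    assume "\<not> ?thesis"
    then have "degree (line a b f - [:y:]) = 0" by simp
    then obtain d where d: "line a b f - [:y:] = [:d:]" by (rule degree_eq_zeroE)
    have "poly (line a b f - [:y:]) 0 = poly (line a b f - [:y:]) 1" by (simp only: d) simp
    with assms show False by simp
  qed
  then obtain s where "poly (line a b f - [:y:]) s = 0"
    using alg_closed_imp_poly_has_root by blast
  then show ?thesis by (auto simp: poly_line)
qed

section \<open>The augmentation filtration\<close>

text \<open>The \<open>k\<close>-th power of the augmentation ideal.\<close>

definition aug :: "nat \<Rightarrow> ('n, 'k::field) free_algebra set" where
  "aug k = {f. \<forall>w. length w < k \<longrightarrow> Poly_Mapping.lookup f w = 0}"

lemma aug_keys: "f \<in> aug k \<longleftrightarrow> (\<forall>w\<in>Poly_Mapping.keys f. k \<le> length w)"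
  by (auto simp: aug_def in_keys_iff simp flip: not_less)

lemma subspace_aug: "free_algebra.subspace (aug k)"
  by (auto simp: free_algebra.subspace_def aug_def lookup_add)

lemmas aug_add = free_algebra.subspace_add[OF subspace_aug]
lemmas aug_diff = free_algebra.subspace_diff[OF subspace_aug]
lemmas aug_sum = free_algebra.subspace_sum[OF subspace_aug]
lemmas aug_scale = free_algebra.subspace_scale[OF subspace_aug]

lemma aug_mono: "f \<in> aug k \<Longrightarrow> l \<le> k \<Longrightarrow> f \<in> aug l"
  by (auto simp: aug_def)

lemma aug_0 [simp]: "f \<in> aug 0"
  by (simp add: aug_def)

lemma aug_mult:
  assumes "f \<in> aug k" "g \<in> aug l"
  shows "f * g \<in> aug (k + l)"
  unfolding aug_keys
proof
  fix w assume "w \<in> Poly_Mapping.keys (f * g)"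
  then obtain u v where "u \<in> Poly_Mapping.keys f" "v \<in> Poly_Mapping.keys g" "w = u + v"
    using keys_mult by blast
  with assms show "k + l \<le> length w"
    by (auto simp: aug_keys plus_list_def add_mono)
qed

lemma gen_in_aug: "gen i \<in> aug (Suc 0)"
  by (auto simp: aug_def lookup_gen)

lemma prod_gen_in_aug: "prod_list (map gen w) \<in> aug (length w)"
  by (auto simp: aug_def lookup_single single_eq_prod_gen[symmetric] when_def)

lemma in_aug_iff_Nil: "f \<in> aug (Suc 0) \<longleftrightarrow> Poly_Mapping.lookup f [] = 0"
  by (auto simp: aug_def)

text \<open>The filtration is separated, since a word of \<open>f\<close> of length \<open>k\<close>
  keeps \<open>f\<close> out of \<open>aug (Suc k)\<close>.\<close>

lemma ex_aug_order:
  assumes "f \<noteq> 0"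
  shows "\<exists>k. f \<in> aug k \<and> f \<notin> aug (Suc k)"
proof (rule ccontr)
  assume *: "\<not> ?thesis"
  have all: "f \<in> aug k" for k
    by (induction k) (use * in auto)
  obtain w where "Poly_Mapping.lookup f w \<noteq> 0"
    using assms by (metis lookup_zero poly_mapping_eqI)
  with all[of "Suc (length w)"] show False by (auto simp: aug_def)
qed

text \<open>The coefficient at \<open>[i]\<close> is the linear coefficient of the restriction to
  the \<open>i\<close>-th coordinate axis, and the coefficient at the empty word is the value at the
  origin.\<close>

lemma aug_2_if_vanishing:
  fixes f :: "('n, 'k::alg_closed_field) free_algebra"
  assumes "vanishing f"
  shows "f \<in> aug 2"
proof -
  have "Poly_Mapping.lookup f [i] = coeff (line (\<lambda>_. 0) (\<lambda>j. if j = i then 1 else 0) f) 1" for i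
  proof (induction f rule: poly_mapping_monomial_induct)
    case (single w c)
    have "line (\<lambda>_. 0) (\<lambda>j. if j = i then 1 else 0) (Poly_Mapping.single w c) =
      smult c (prod_list (map (\<lambda>j. [:0, if j = i then 1 else 0:]) w))"
      by (simp add: line_def poly_algebra.free_lift_single)
    then show ?case
      by (cases w; cases "tl w") (auto simp: lookup_single when_def coeff_pCons split: nat.splits)
  qed (simp add: lookup_add line.add)
  then have "Poly_Mapping.lookup f [i] = 0" for i
    using line_eq_0[OF assms] by simp
  moreover have "Poly_Mapping.lookup f [] = 0"
    using assms by (simp add: lookup_Nil_eq_ev vanishing_def)
  moreover have "w = [] \<or> (\<exists>i. w = [i])" if "length w < 2" for w :: "'n list"
    using that by (cases w; cases "tl w") auto
  ultimately show ?thesis by (auto simp: aug_def)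
qed

section \<open>Endomorphisms congruent to the identity modulo the square of the augmentation
  ideal\<close>

locale unipotent_endo = algebra_hom free_scale free_scale \<theta>
  for \<theta> :: "('n, 'k::field) free_algebra \<Rightarrow> ('n, 'k) free_algebra" +
  assumes gen_diff: "\<theta> (gen i) - gen i \<in> aug 2"
begin

text \<open>For a letter \<open>z\<close> and a word \<open>u\<close>, \<theta>(z u) - z u splits as
  (\<theta> z - z) \<theta> u + z (\<theta> u - u), and both summands gain one degree.\<close>

lemma prod_gen_diff:
  "\<theta> (prod_list (map gen w)) - prod_list (map gen w) \<in> aug (Suc (length w))"
proof (induction w)
  case Nil
  then show ?case by (simp add: hom_one aug_def)
next
  case (Cons i w)
  let ?u = "prod_list (map gen w)"
  have "(\<theta> ?u - ?u) + ?u \<in> aug (length w)"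
    by (rule aug_add) (use aug_mono[OF Cons] prod_gen_in_aug in auto)
  then have "(\<theta> (gen i) - gen i) * \<theta> ?u \<in> aug (2 + length w)"
    by (intro aug_mult gen_diff) simp
  moreover have "gen i * (\<theta> ?u - ?u) \<in> aug (Suc 0 + Suc (length w))"
    by (intro aug_mult gen_in_aug Cons)
  ultimately have "(\<theta> (gen i) - gen i) * \<theta> ?u + gen i * (\<theta> ?u - ?u) \<in> aug (Suc (Suc (length w)))"
    by (intro aug_add) simp_all
  then show ?case by (simp add: hom_mult algebra_simps)
qed

lemma diff_in_aug:
  assumes "f \<in> aug k"
  shows "\<theta> f - f \<in> aug (Suc k)"
proof -
  let ?t = "\<lambda>w. free_scale (Poly_Mapping.lookup f w) (prod_list (map gen w))"
  have f: "f = (\<Sum>w\<in>Poly_Mapping.keys f. ?t w)" by (rule free_algebra_expand)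
  then have "\<theta> f - f = (\<Sum>w\<in>Poly_Mapping.keys f. \<theta> (?t w)) - (\<Sum>w\<in>Poly_Mapping.keys f. ?t w)"
    by (metis sum)
  also have "\<dots> = (\<Sum>w\<in>Poly_Mapping.keys f. free_scale (Poly_Mapping.lookup f w)
      (\<theta> (prod_list (map gen w)) - prod_list (map gen w)))"
    by (simp add: scale sum_subtractf free_algebra.scale_right_diff_distrib)
  also have "\<dots> \<in> aug (Suc k)"
    using assms[unfolded aug_keys] by (intro aug_sum aug_scale aug_mono[OF prod_gen_diff]) simp
  finally show ?thesis .
qed

text \<open>Modulo \<open>aug (Suc k)\<close>, where \<open>k\<close> is the order of
  \<open>f\<close>, the map fixes \<open>f\<close> and also multiplies it by
  \<open>c\<close>.\<close>

lemma eigenvalue_eq_1: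
  assumes "\<theta> f = free_scale c f" "f \<noteq> 0"
  shows "c = 1"
proof (rule ccontr)
  assume "c \<noteq> 1"
  obtain k where k: "f \<in> aug k" "f \<notin> aug (Suc k)" using ex_aug_order[OF assms(2)] by blast
  have "free_scale (c - 1) f \<in> aug (Suc k)"
    using diff_in_aug[OF k(1)] assms(1) by (simp add: free_algebra.scale_left_diff_distrib)
  then have "free_scale (inverse (c - 1)) (free_scale (c - 1) f) \<in> aug (Suc k)"
    by (rule aug_scale)
  with \<open>c \<noteq> 1\<close> k(2) show False by simp
qed

lemma inj: "inj \<theta>"
proof (rule injI)
  fix f g assume "\<theta> f = \<theta> g"
  \<comment> \<open>A nonzero element of the kernel would be an eigenvector with eigenvalue
    0.\<close>
  then have "\<theta> (f - g) = free_scale 0 (f - g)" by (simp add: diff)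
  then show "f = g" using eigenvalue_eq_1[of "f - g" 0] by auto
qed

end

section \<open>Graded algebras\<close>

text \<open>The grading is encoded by its projections \<open>p \<alpha>\<close> onto the homogeneous
  parts, so that transporting it along an automorphism is plain conjugation.\<close>

locale algebra_grading = assoc_algebra scale
  for scale :: "'k::field \<Rightarrow> 'a::ring_1 \<Rightarrow> 'a" +
  fixes p :: "'g::comm_monoid_add \<Rightarrow> 'a \<Rightarrow> 'a"
  assumes p_add: "p \<alpha> (x + y) = p \<alpha> x + p \<alpha> y"
    and p_scale: "p \<alpha> (scale c x) = scale c (p \<alpha> x)"
    and p_p: "p \<alpha> (p \<beta> x) = (if \<alpha> = \<beta> then p \<alpha> x else 0)"
    and finite_p: "finite {\<alpha>. p \<alpha> x \<noteq> 0}"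
    and sum_p: "(\<Sum>\<alpha> | p \<alpha> x \<noteq> 0. p \<alpha> x) = x"
    and p_mult_p: "p (\<alpha> + \<beta>) (p \<alpha> x * p \<beta> y) = p \<alpha> x * p \<beta> y"
    and p_one: "p 0 1 = 1"
begin

sublocale p: Vector_Spaces.linear scale scale "p \<alpha>" for \<alpha>
  by unfold_locales (simp_all add: p_add p_scale)

definition homogeneous :: "'g \<Rightarrow> 'a \<Rightarrow> bool" where
  "homogeneous \<alpha> x \<longleftrightarrow> p \<alpha> x = x"

lemma homogeneous_p [simp]: "homogeneous \<alpha> (p \<alpha> x)"
  by (simp add: homogeneous_def p_p)

lemma p_homogeneous: "homogeneous \<beta> x \<Longrightarrow> p \<alpha> x = (if \<alpha> = \<beta> then x else 0)"
  using p_p[of \<alpha> \<beta> x] unfolding homogeneous_def by auto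

lemma homogeneous_mult:
  "homogeneous \<alpha> x \<Longrightarrow> homogeneous \<beta> y \<Longrightarrow> homogeneous (\<alpha> + \<beta>) (x * y)"
  unfolding homogeneous_def by (metis p_mult_p)

lemma homogeneous_one: "homogeneous 0 1"
  by (simp add: homogeneous_def p_one)

lemma homogeneous_scale: "homogeneous \<alpha> x \<Longrightarrow> homogeneous \<alpha> (scale c x)"
  by (simp add: homogeneous_def p_scale)

lemma homogeneous_sum:
  "(\<And>i. i \<in> A \<Longrightarrow> homogeneous \<alpha> (x i)) \<Longrightarrow> homogeneous \<alpha> (\<Sum>i\<in>A. x i)"
  by (simp add: homogeneous_def p.sum)

lemma homogeneous_prod_list:
  assumes "\<And>i. homogeneous (d i) (x i)"
  shows "homogeneous (sum_list (map d w)) (prod_list (map x w))"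
  by (induction w) (auto intro: homogeneous_one homogeneous_mult assms)

text \<open>Only products of components whose weights add up to \<open>\<alpha>\<close> contribute.
  The subspace \<open>U\<close> is later a power of the augmentation ideal or the space of vanishing
  elements.\<close>

lemma p_mult_in_subspace:
  assumes "subspace U" "\<And>\<beta> \<gamma>. \<alpha> = \<beta> + \<gamma> \<Longrightarrow> p \<beta> x * p \<gamma> y \<in> U"
  shows "p \<alpha> (x * y) \<in> U"
proof -
  let ?A = "{\<beta>. p \<beta> x \<noteq> 0}" and ?B = "{\<gamma>. p \<gamma> y \<noteq> 0}"
  have "x * y = (\<Sum>\<beta>\<in>?A. \<Sum>\<gamma>\<in>?B. p \<beta> x * p \<gamma> y)"
    by (subst (1) sum_p[of x, symmetric], subst (1) sum_p[of y, symmetric]) (rule sum_product)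
  then have "p \<alpha> (x * y) = (\<Sum>\<beta>\<in>?A. \<Sum>\<gamma>\<in>?B. p \<alpha> (p \<beta> x * p \<gamma> y))"
    by (simp add: p.sum)
  also have "\<dots> = (\<Sum>\<beta>\<in>?A. \<Sum>\<gamma>\<in>?B. if \<alpha> = \<beta> + \<gamma> then p \<beta> x * p \<gamma> y else 0)"
    by (intro sum.cong refl p_homogeneous homogeneous_mult homogeneous_p)
  also have "\<dots> \<in> U"
    using assms by (auto intro!: subspace_sum simp: subspace_0)
  finally show ?thesis .
qed

text \<open>Serves for two coordinate changes: moving the fixed point to the origin, and
  straightening the linear parts of homogeneous elements.\<close>

lemma grading_transport:
  assumes "algebra_automorphism scale \<phi>"
  shows "algebra_grading scale (\<lambda>\<alpha>. \<phi> \<circ> p \<alpha> \<circ> inv \<phi>)"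
proof -
  interpret f: algebra_hom scale scale \<phi>
    using assms by (simp add: algebra_automorphism_def)
  have bij: "bij \<phi>" using assms by (simp add: algebra_automorphism_def)
  note [simp] = inv_f_f[OF bij_is_inj[OF bij]] surj_f_inv_f[OF bij_is_surj[OF bij]]
  have inj: "\<phi> x = \<phi> y \<longleftrightarrow> x = y" for x y using bij by (metis bij_pointE)
  have inv_add: "inv \<phi> (x + y) = inv \<phi> x + inv \<phi> y" for x y
    by (subst inj[symmetric]) (simp add: f.add)
  have inv_scale: "inv \<phi> (scale c x) = scale c (inv \<phi> x)" for c x
    by (subst inj[symmetric]) (simp add: f.scale)
  have inv_one: "inv \<phi> 1 = 1"
    by (subst inj[symmetric]) (simp add: f.hom_one)
  have zero: "\<phi> x = 0 \<longleftrightarrow> x = 0" for x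
    using inj[of x 0] by (simp add: f.zero)
  show ?thesis
  proof
    fix x
    have "(\<Sum>\<alpha> | p \<alpha> (inv \<phi> x) \<noteq> 0. \<phi> (p \<alpha> (inv \<phi> x))) = x"
      by (simp flip: f.sum add: sum_p)
    then show "(\<Sum>\<alpha> | (\<phi> \<circ> p \<alpha> \<circ> inv \<phi>) x \<noteq> 0. (\<phi> \<circ> p \<alpha> \<circ> inv \<phi>) x) = x"
      by (simp add: zero)
  qed (auto simp: inv_add inv_scale p_add p_scale f.add f.scale p_p zero finite_p inv_one p_one
      f.hom_one p_mult_p f.hom_mult simp flip: f.hom_mult)
qed

end

text \<open>For a torus action the added assumption says that the origin is a fixed point.\<close>

locale augmented_grading = algebra_grading free_scale p
  for p :: "'g::comm_monoid_add \<Rightarrow> ('n, 'k::field) free_algebra \<Rightarrow> ('n, 'k) free_algebra" +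
  assumes p_aug_1: "f \<in> aug (Suc 0) \<Longrightarrow> p \<alpha> f \<in> aug (Suc 0)"
begin

lemma p_aug:
  assumes "f \<in> aug k"
  shows "p \<alpha> f \<in> aug k"
proof -
  have w: "p \<alpha> (prod_list (map gen w)) \<in> aug (length w)" for w \<alpha>
  proof (induction w arbitrary: \<alpha>)
    case (Cons i w)
    have "p \<beta> (gen i) * p \<gamma> (prod_list (map gen w)) \<in> aug (Suc 0 + length w)" for \<beta> \<gamma>
      by (intro aug_mult p_aug_1 gen_in_aug Cons.IH)
    then have "p \<alpha> (gen i * prod_list (map gen w)) \<in> aug (Suc 0 + length w)"
      by (intro p_mult_in_subspace subspace_aug)
    then show ?case by simp
  qed simp
  let ?t = "\<lambda>w. free_scale (Poly_Mapping.lookup f w) (prod_list (map gen w))"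
  have "p \<alpha> f = (\<Sum>w\<in>Poly_Mapping.keys f. p \<alpha> (?t w))"
    by (subst (1) free_algebra_expand[of f]) (simp only: p.sum)
  also have "\<dots> \<in> aug k"
    unfolding p_scale using assms[unfolded aug_keys] by (intro aug_sum aug_scale aug_mono[OF w]) simp
  finally show ?thesis .
qed

end

text \<open>The substitution \<open>\<theta>\<close> replaces each generator by a homogeneous
  element of weight \<open>d i\<close> with the same linear part and no constant term. Linearizing
  amounts to showing that \<open>\<theta>\<close> is bijective.\<close>

locale normalized_grading = augmented_grading p + unipotent_endo \<theta>
  for p :: "'g::comm_monoid_add \<Rightarrow> ('n, 'k::field) free_algebra \<Rightarrow> ('n, 'k) free_algebra"
    and \<theta> :: "('n, 'k::field) free_algebra \<Rightarrow> ('n, 'k) free_algebra" +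
  fixes d :: "'n \<Rightarrow> 'g"
  assumes homogeneous_gen: "homogeneous (d i) (\<theta> (gen i))"
begin

definition weight :: "'n list \<Rightarrow> 'g" where
  "weight w = sum_list (map d w)"

lemma homogeneous_word: "homogeneous (weight w) (\<theta> (prod_list (map gen w)))"
proof -
  have "homogeneous (sum_list (map d w)) (prod_list (map (\<lambda>i. \<theta> (gen i)) w))"
    by (rule homogeneous_prod_list) (rule homogeneous_gen)
  then show ?thesis by (simp add: weight_def hom_prod_list comp_def)
qed

text \<open>Rewriting the words of length \<open>k\<close> of \<open>x\<close> in the elements
  \<open>\<theta> (gen i)\<close> changes only higher degrees. Projecting to weight
  \<open>\<alpha>\<close> then discards the words of other weights and, by \<open>p_aug\<close>,
  does not lower the order of the error.\<close>

lemma leading_term: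
  assumes hom: "homogeneous \<alpha> x" and k: "x \<in> aug k" "x \<notin> aug (Suc k)"
  shows "\<exists>w. length w = k \<and> weight w = \<alpha>"
    and "\<exists>y. homogeneous \<alpha> (x - \<theta> y) \<and> x - \<theta> y \<in> aug (Suc k)"
proof -
  define t where "t w = free_scale (Poly_Mapping.lookup x w) (prod_list (map gen w))" for w
  define T where "T = {w \<in> Poly_Mapping.keys x. length w = k}"
  have fin: "finite T" by (simp add: T_def)
  have "x = (\<Sum>w\<in>Poly_Mapping.keys x. t w)"
    unfolding t_def by (rule free_algebra_expand)
  also have "\<dots> = (\<Sum>w\<in>T. t w) + (\<Sum>w\<in>Poly_Mapping.keys x - T. t w)"
    by (subst add.commute, rule sum.subset_diff) (auto simp: T_def)
  finally have "x - (\<Sum>w\<in>T. t w) = (\<Sum>w\<in>Poly_Mapping.keys x - T. t w)"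
    by (simp add: algebra_simps)
  also have "\<dots> \<in> aug (Suc k)"
    unfolding t_def
    by (intro aug_sum aug_scale aug_mono[OF prod_gen_in_aug])
      (use k in \<open>auto simp: aug_keys T_def Suc_le_eq order.not_eq_order_implies_strict\<close>)
  finally have 1: "x - (\<Sum>w\<in>T. t w) \<in> aug (Suc k)" .
  have 2: "\<theta> (\<Sum>w\<in>T. t w) - (\<Sum>w\<in>T. t w) \<in> aug (Suc k)"
    unfolding t_def
    by (intro diff_in_aug aug_sum aug_scale) (auto simp: T_def intro: prod_gen_in_aug)
  have 3: "x - \<theta> (\<Sum>w\<in>T. t w) \<in> aug (Suc k)"
    using aug_diff[OF 1 2] by simp
  define y where "y = (\<Sum>w\<in>{w\<in>T. weight w = \<alpha>}. t w)"
  have "p \<alpha> (\<theta> (t w)) = (if weight w = \<alpha> then \<theta> (t w) else 0)" for w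
    using p_homogeneous[OF homogeneous_word[of w], of \<alpha>] by (auto simp: t_def scale p_scale)
  then have "p \<alpha> (\<theta> (\<Sum>w\<in>T. t w)) = \<theta> y"
    unfolding y_def sum p.sum using fin by (simp add: sum.inter_filter)
  then have eq: "p \<alpha> (x - \<theta> (\<Sum>w\<in>T. t w)) = x - \<theta> y"
    using hom by (simp add: p.diff homogeneous_def)
  have y: "homogeneous \<alpha> (x - \<theta> y)" "x - \<theta> y \<in> aug (Suc k)"
    using p_aug[OF 3] unfolding eq[symmetric] by simp_all
  then show "\<exists>y. homogeneous \<alpha> (x - \<theta> y) \<and> x - \<theta> y \<in> aug (Suc k)" by blast
  \<comment> \<open>If no word of length \<open>k\<close> had weight \<open>\<alpha>\<close>, then
    \<open>y\<close> would be an empty sum and \<open>x\<close> would lie in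
    \<open>aug (Suc k)\<close>.\<close>
  have "y \<noteq> 0" using y(2) k(2) by (auto simp: zero)
  then show "\<exists>w. length w = k \<and> weight w = \<alpha>"
    by (auto simp: y_def T_def intro: sum.neutral)
qed

lemma ex_weight:
  assumes "homogeneous \<alpha> x" "x \<noteq> 0"
  shows "\<exists>w. weight w = \<alpha>"
  using leading_term(1)[OF assms(1)] ex_aug_order[OF assms(2)] by blast

text \<open>After the leading term of a homogeneous \<open>x\<close> is removed, a nonzero remainder
  would have the same weight and larger order, so a longer word would share that weight. Hence
  \<open>x\<close> equals its leading term.\<close>

lemma bij_if_length_determined:
  assumes "\<And>v w. weight v = weight w \<Longrightarrow> length v = length w"
  shows "bij \<theta>"
proof -
  have hom: "x \<in> range \<theta>" if x: "homogeneous \<alpha> x" for \<alpha> x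
  proof (cases "x = 0")
    case True
    then show ?thesis using zero by (metis rangeI)
  next
    case False
    then obtain k where k: "x \<in> aug k" "x \<notin> aug (Suc k)" using ex_aug_order by blast
    obtain w where w: "length w = k" "weight w = \<alpha>" using leading_term(1)[OF x k] by blast
    obtain y where y: "homogeneous \<alpha> (x - \<theta> y)" "x - \<theta> y \<in> aug (Suc k)"
      using leading_term(2)[OF x k] by blast
    have "x - \<theta> y = 0"
    proof (rule ccontr)
      assume "x - \<theta> y \<noteq> 0"
      then obtain l where l: "x - \<theta> y \<in> aug l" "x - \<theta> y \<notin> aug (Suc l)"
        using ex_aug_order by blast
      obtain v where v: "length v = l" "weight v = \<alpha>" using leading_term(1)[OF y(1) l] by blast
      have "l = k" using assms[of v w] v w by simp
      with l(2) y(2) show False by simp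
    qed
    then show ?thesis by auto
  qed
  have "x \<in> range \<theta>" for x
  proof -
    have "free_algebra.subspace (range \<theta>)"
      using subspace_image[OF free_algebra.subspace_UNIV] .
    then have "(\<Sum>\<alpha> | p \<alpha> x \<noteq> 0. p \<alpha> x) \<in> range \<theta>"
      by (rule free_algebra.subspace_sum) (rule hom[OF homogeneous_p])
    then show ?thesis by (simp only: sum_p)
  qed
  then show ?thesis using inj by (auto simp: bij_def)
qed

end

section \<open>Homogeneous generators at a fixed point\<close>

interpretation free_pair: vector_space_pair free_scale free_scale ..

lemma independent_range_gen: "free_algebra.independent (range (gen :: 'n::finite \<Rightarrow> ('n, 'k::field) free_algebra))"
proof (rule free_algebra.independent_if_scalars_zero)
  fix u :: "('n, 'k) free_algebra \<Rightarrow> 'k" and x :: "('n, 'k) free_algebra"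
  assume *: "(\<Sum>x\<in>range gen. free_scale (u x) x) = 0" and "x \<in> range gen"
  then obtain i where i: "x = gen i" by auto
  have inj: "inj (gen :: 'n \<Rightarrow> ('n, 'k) free_algebra)"
    by (rule injI) (metis lookup_gen list.inject zero_neq_one)
  have "0 = Poly_Mapping.lookup (\<Sum>x\<in>range gen. free_scale (u x) x) [i]"
    by (simp only: *) simp
  also have "\<dots> = u (gen i)"
    by (simp add: lookup_sum sum.reindex[OF inj] lookup_gen if_distrib cong: if_cong)
  finally show "u x = 0" using i by simp
qed simp

lemma algebra_hom_aug:
  assumes "algebra_hom free_scale free_scale \<phi>" "\<And>i. \<phi> (gen i) \<in> aug (Suc 0)" "f \<in> aug k"
  shows "\<phi> f \<in> aug k"
proof -
  interpret f: algebra_hom free_scale free_scale \<phi> by fact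
  have w: "\<phi> (prod_list (map gen w)) \<in> aug (length w)" for w
    by (induction w) (auto simp: f.hom_mult f.hom_one intro: aug_mult[of _ "Suc 0", simplified] assms(2))
  have "\<phi> f = (\<Sum>w\<in>Poly_Mapping.keys f.
      free_scale (Poly_Mapping.lookup f w) (\<phi> (prod_list (map gen w))))"
    by (subst (1) free_algebra_expand[of f]) (simp only: f.sum f.scale)
  also have "\<dots> \<in> aug k"
    using assms(3)[unfolded aug_keys] by (intro aug_sum aug_scale aug_mono[OF w]) simp
  finally show ?thesis .
qed

definition linear_part :: "('n::finite, 'k::field) free_algebra \<Rightarrow> ('n, 'k) free_algebra" where
  "linear_part f = (\<Sum>i\<in>UNIV. free_scale (Poly_Mapping.lookup f [i]) (gen i))"

interpretation linear_part: Vector_Spaces.linear free_scale free_scale linear_part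
  by unfold_locales
    (simp_all add: linear_part_def lookup_add free_algebra.scale_left_distrib sum.distrib
      free_algebra.scale_sum_right)

lemma linear_part_gen [simp]: "linear_part (gen i) = gen i"
proof -
  have "linear_part (gen i) = (\<Sum>j\<in>UNIV. if j = i then gen i else 0)"
    unfolding linear_part_def by (intro sum.cong refl) (simp add: lookup_gen)
  then show ?thesis by simp
qed

lemma linear_part_in_span: "linear_part f \<in> free_algebra.span (range gen)"
  unfolding linear_part_def
  by (intro free_algebra.span_sum free_algebra.span_scale free_algebra.span_base) simp

lemma diff_linear_part:
  assumes "f \<in> aug (Suc 0)"
  shows "f - linear_part f \<in> aug 2"
  unfolding aug_def mem_Collect_eq
proof (intro allI impI)
  fix w :: "'a list" assume "length w < 2"
  then consider "w = []" | j where "w = [j]" by (cases w; cases "tl w") auto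
  then show "Poly_Mapping.lookup (f - linear_part f) w = 0"
  proof cases
    case 1
    then show ?thesis
      using assms by (simp add: lookup_minus linear_part_def lookup_sum lookup_gen in_aug_iff_Nil)
  next
    case 2
    then show ?thesis
      by (simp add: lookup_minus linear_part_def lookup_sum lookup_gen if_distrib cong: if_cong)
  qed
qed

lemma span_gen_subset_aug: "free_algebra.span (range gen) \<subseteq> aug (Suc 0)"
  by (rule free_algebra.span_minimal) (auto intro: subspace_aug gen_in_aug)

text \<open>Components of generators are homogeneous elements of the augmentation ideal, so linear
  parts of such elements span all linear forms and a basis can be picked among them. The base change
  comes with its inverse, both preserving the augmentation ideal, so that the filtration can be
  carried both ways.\<close>

lemma ex_homogeneous_linear_basis:
  fixes p :: "'g::comm_monoid_add \<Rightarrow> ('n::finite, 'k::field) free_algebra \<Rightarrow> ('n, 'k) free_algebra"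
  assumes "augmented_grading p"
  obtains L L' :: "('n, 'k) free_algebra \<Rightarrow> ('n, 'k) free_algebra" and f d
    where "algebra_hom free_scale free_scale L" "algebra_hom free_scale free_scale L'"
    "L \<circ> L' = id" "L' \<circ> L = id"
    "\<And>i. L (gen i) \<in> aug (Suc 0)" "\<And>i. L' (gen i) \<in> aug (Suc 0)"
    "\<And>i. f i - L (gen i) \<in> aug 2" "\<And>i. p (d i) (f i) = f i"
proof -
  interpret augmented_grading p by fact
  define H where "H = {x \<in> aug (Suc 0). \<exists>\<alpha>. homogeneous \<alpha> x}"
  let ?V = "free_algebra.span (range gen)"
  obtain B where B: "B \<subseteq> linear_part ` H" "free_algebra.independent B"
    "linear_part ` H \<subseteq> free_algebra.span B"
    \<comment> \<open>Choosing \<open>B\<close> inside the image of \<open>H\<close> lets each basis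
      vector be lifted to a homogeneous element at the end.\<close>
    using free_algebra.maximal_independent_subset .
  have "gen i \<in> free_algebra.span B" for i
  proof -
    have "linear_part (\<Sum>\<alpha> | p \<alpha> (gen i) \<noteq> 0. p \<alpha> (gen i)) \<in> free_algebra.span B"
      unfolding linear_part.sum using B(3)
      by (intro free_algebra.span_sum) (auto simp: H_def intro!: p_aug_1 gen_in_aug exI homogeneous_p)
    then show ?thesis by (simp only: sum_p linear_part_gen)
  qed
  then have span_B: "free_algebra.span B = ?V"
    using B(1) linear_part_in_span
    by (intro free_algebra.span_eq[THEN iffD2] conjI) auto
  obtain b' where b': "bij_betw b' (range (gen :: 'n \<Rightarrow> ('n, 'k) free_algebra)) B"
    using free_algebra.bij_if_span_eq_span_bases[OF independent_range_gen B(2) span_B[symmetric]] by blast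
  define b where "b i = b' (gen i)" for i
  have range_b: "range b = B"
    using bij_betw_imp_surj_on[OF b'] by (auto simp: b_def)
  have "inj b"
  proof (rule injI)
    fix i j assume "b i = b j"
    then have "(gen i :: ('n, 'k) free_algebra) = gen j"
      using bij_betw_imp_inj_on[OF b'] by (auto simp: b_def dest: inj_onD)
    then show "i = j" by (metis lookup_gen list.inject zero_neq_one)
  qed
  \<comment> \<open>\<open>M\<close> inverts the base change on linear forms; \<open>L'\<close> is
    its multiplicative extension.\<close>
  obtain M where M: "Vector_Spaces.linear free_scale free_scale M" "\<forall>x\<in>B. M x = gen (inv b x)"
    using free_pair.linear_independent_extend[OF B(2), of "\<lambda>x. gen (inv b x)"] by blast
  interpret M: Vector_Spaces.linear free_scale free_scale M by fact
  have M_b: "M (b i) = gen i" for i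
    using M(2) range_b \<open>inj b\<close> by auto
  define L where "L = free_lift free_scale b"
  define L' where "L' = free_lift free_scale (M \<circ> gen)"
  interpret L: algebra_hom free_scale free_scale L
    unfolding L_def by (rule free_algebra.algebra_hom_free_lift)
  interpret L': algebra_hom free_scale free_scale L'
    unfolding L'_def by (rule free_algebra.algebra_hom_free_lift)
  have L_gen: "L (gen i) = b i" and L'_gen: "L' (gen i) = M (gen i)" for i
    by (simp_all add: L_def L'_def)
  have b_in: "b i \<in> ?V" for i
    using free_algebra.span_base[of "b i" B] range_b span_B by auto
  have M_in: "M (gen i) \<in> ?V" for i
  proof -
    have "M ` free_algebra.span B \<subseteq> ?V"
      unfolding M.span_image[symmetric]
      by (rule free_algebra.span_mono) (use range_b M_b in auto)
    then show ?thesis using free_algebra.span_base[of "gen i" "range gen"] span_B by auto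
  qed
  have "L (M x) = x" if "x \<in> ?V" for x
  proof -
    have "(L \<circ> M) x = id x"
    proof (rule free_pair.linear_eq_on_span[where B = B and f = "L \<circ> M" and g = id and x = x])
      show "Vector_Spaces.linear free_scale free_scale (L \<circ> M)"
        by (rule Vector_Spaces.linear_compose[OF M.linear_axioms L.linear_axioms])
      show "(L \<circ> M) y = id y" if y: "y \<in> B" for y
      proof -
        obtain i where "y = b i" using y unfolding range_b[symmetric] by blast
        then show ?thesis by (simp add: M_b L_gen)
      qed
      show "x \<in> free_algebra.span B" using that span_B by simp
    qed (rule free_algebra.linear_id)
    then show ?thesis by simp
  qed
  then have LL': "L \<circ> L' = id"
    by (intro free_algebra_hom_eqI[OF algebra_hom_comp[OF L'.algebra_hom_axioms L.algebra_hom_axioms]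
          free_algebra.algebra_hom_id])
      (simp add: L'_gen free_algebra.span_base)
  have "L' x = M x" if "x \<in> ?V" for x
    by (rule free_pair.linear_eq_on_span[OF L'.linear_axioms M.linear_axioms _ that])
      (auto simp: L'_gen)
  then have L'L: "L' \<circ> L = id"
    by (intro free_algebra_hom_eqI[OF algebra_hom_comp[OF L.algebra_hom_axioms L'.algebra_hom_axioms]
          free_algebra.algebra_hom_id])
      (simp add: L_gen b_in M_b)
  have "\<exists>x \<alpha>. x \<in> aug (Suc 0) \<and> homogeneous \<alpha> x \<and> b i = linear_part x" for i
  proof -
    have "b i \<in> linear_part ` H" using B(1) unfolding range_b[symmetric] by auto
    then show ?thesis unfolding H_def by auto
  qed
  then obtain f d where f: "\<And>i. f i \<in> aug (Suc 0)" "\<And>i. homogeneous (d i) (f i)"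
    "\<And>i. b i = linear_part (f i)"
    by metis
  show thesis
  proof (rule that[OF L.algebra_hom_axioms L'.algebra_hom_axioms LL' L'L])
    show "L (gen i) \<in> aug (Suc 0)" "L' (gen i) \<in> aug (Suc 0)" for i
      using b_in M_in span_gen_subset_aug by (auto simp: L_gen L'_gen)
    show "f i - L (gen i) \<in> aug 2" for i
      using diff_linear_part[OF f(1)] by (simp add: L_gen f(3))
    show "p (d i) (f i) = f i" for i
      using f(2) by (simp add: homogeneous_def)
  qed
qed

text \<open>Conjugating with the linear base change reaches the normalized situation. The hypothesis
  \<open>len\<close> ranges over all \<open>d\<close>, because the weights of the chosen elements
  are found only inside the proof.\<close>

lemma augmented_grading_linearizable:
  fixes p :: "'g::comm_monoid_add \<Rightarrow> ('n::finite, 'k::field) free_algebra \<Rightarrow> ('n, 'k) free_algebra"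
  assumes "augmented_grading p"
    and len: "\<And>d :: 'n \<Rightarrow> 'g. (\<And>\<alpha> x. p \<alpha> x \<noteq> 0 \<Longrightarrow> \<exists>w. sum_list (map d w) = \<alpha>) \<Longrightarrow>
      (\<And>v w. sum_list (map d v) = sum_list (map d w) \<Longrightarrow> length v = length w)"
  shows "\<exists>\<beta> d. algebra_automorphism free_scale \<beta> \<and> (\<forall>i. p (d i) (\<beta> (gen i)) = \<beta> (gen i))"
proof -
  interpret augmented_grading p by fact
  obtain L L' :: "('n, 'k) free_algebra \<Rightarrow> ('n, 'k) free_algebra" and f d
    where L: "algebra_hom free_scale free_scale L"
    and L': "algebra_hom free_scale free_scale L'"
    and LL': "L \<circ> L' = id" and L'L: "L' \<circ> L = id"
    and aug: "\<And>i. L (gen i) \<in> aug (Suc 0)" "\<And>i. L' (gen i) \<in> aug (Suc 0)"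
    and f: "\<And>i. f i - L (gen i) \<in> aug 2" "\<And>i. p (d i) (f i) = f i"
    using ex_homogeneous_linear_basis[OF assms(1)] by blast
  interpret L: algebra_hom free_scale free_scale L by fact
  interpret L': algebra_hom free_scale free_scale L' by fact
  have [simp]: "L (L' x) = x" "L' (L x) = x" for x
    using LL' L'L by (metis comp_apply id_apply)+
  have inv: "inv L' = L" using LL' L'L by (simp add: inv_unique_comp)
  define q where "q = (\<lambda>\<alpha>. L' \<circ> p \<alpha> \<circ> L)"
  interpret q: algebra_grading free_scale q
    using grading_transport[OF algebra_automorphism_inverse[OF L' L L'L LL']]
    by (simp add: q_def inv)
  define \<theta> where "\<theta> = free_lift free_scale (\<lambda>i. L' (f i))"
  interpret \<theta>: algebra_hom free_scale free_scale \<theta>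
    unfolding \<theta>_def by (rule free_algebra.algebra_hom_free_lift)
  have \<theta>_gen: "\<theta> (gen i) = L' (f i)" for i by (simp add: \<theta>_def)
  interpret q: normalized_grading q \<theta> d
  proof
    show "q \<alpha> x \<in> aug (Suc 0)" if "x \<in> aug (Suc 0)" for \<alpha> x
      using that by (auto simp: q_def intro!: algebra_hom_aug[OF L'] algebra_hom_aug[OF L] p_aug_1 aug)
    show "\<theta> (gen i) - gen i \<in> aug 2" for i
      using algebra_hom_aug[OF L' aug(2) f(1)] by (simp add: \<theta>_gen L'.diff)
    show "q.homogeneous (d i) (\<theta> (gen i))" for i
      unfolding q.homogeneous_def by (simp add: \<theta>_gen q_def f(2))
  qed
  \<comment> \<open>The gradings \<open>p\<close> and \<open>q\<close> have the same weights, so the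
    leading-term argument for \<open>q\<close> also describes the weights of
    \<open>p\<close>.\<close>
  have "\<exists>w. sum_list (map d w) = \<alpha>" if "p \<alpha> x \<noteq> 0" for \<alpha> x
  proof (rule q.ex_weight[unfolded q.weight_def])
    show "q.homogeneous \<alpha> (q \<alpha> (L' x))" by simp
    have "L (L' (p \<alpha> x)) \<noteq> L 0" using that by (simp add: L.zero)
    then have "L' (p \<alpha> x) \<noteq> 0" by metis
    then show "q \<alpha> (L' x) \<noteq> 0" by (simp add: q_def)
  qed
  then have "length v = length w" if "q.weight v = q.weight w" for v w
    using len that unfolding q.weight_def by blast
  then have "bij \<theta>" by (rule q.bij_if_length_determined)
  moreover have "bij L" using L'L LL' by (rule o_bij)
  ultimately have "algebra_automorphism free_scale (L \<circ> \<theta>)"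
    unfolding algebra_automorphism_def
    by (intro conjI bij_comp algebra_hom_comp[OF \<theta>.algebra_hom_axioms L])
  \<comment> \<open>Undoing the base change, \<open>L \<circ> \<theta>\<close> sends
    \<open>gen i\<close> to the original homogeneous element \<open>f i\<close>.\<close>
  moreover have "p (d i) ((L \<circ> \<theta>) (gen i)) = (L \<circ> \<theta>) (gen i)" for i
    by (simp add: \<theta>_gen f(2))
  ultimately show ?thesis by blast
qed

section \<open>Integer vectors\<close>

lemma ex_common_denominator:
  fixes c :: "'n::finite \<Rightarrow> rat"
  shows "\<exists>N::int. N \<noteq> 0 \<and> (\<forall>i. \<exists>m. of_int N * c i = of_int m)"
proof -
  define q where "q i = snd (quotient_of (c i))" for i
  have q: "q i > 0" "c i = of_int (fst (quotient_of (c i))) / of_int (q i)" for i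
    by (simp_all add: q_def quotient_of_denom_pos' quotient_of_div)
  have "of_int (prod q UNIV) * c i = of_int (prod q (UNIV - {i}) * fst (quotient_of (c i)))" for i
    using q(1)[of i] by (subst q(2), subst prod.remove[of UNIV i]) simp_all
  moreover have "prod q UNIV \<noteq> 0" using q(1) by (simp add: less_imp_neq[symmetric])
  ultimately show ?thesis by blast
qed

text \<open>After clearing denominators the columns are independent over the rationals. A left
  inverse of a square matrix is a right inverse, so the rows are independent too.\<close>

lemma int_square_rows_independent:
  fixes d :: "'n::finite \<Rightarrow> 'n \<Rightarrow> int"
  assumes cols: "\<And>l. (\<And>i. (\<Sum>j\<in>UNIV. l j * d i j) = 0) \<Longrightarrow> l = 0"
    and b: "\<And>j. (\<Sum>i\<in>UNIV. b i * d i j) = 0"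
  shows "b = 0"
proof -
  define A :: "rat^'n^'n" where "A = (\<chi> i j. of_int (d i j))"
  have "\<forall>c. sum (\<lambda>j. c j *s column j A) UNIV = 0 \<longrightarrow> (\<forall>j. c j = 0)"
  proof (intro allI impI)
    fix c j assume c: "sum (\<lambda>j. c j *s column j A) UNIV = 0"
    obtain N :: int and m where N: "N \<noteq> 0" "\<And>j. of_int N * c j = of_int (m j)"
      using ex_common_denominator[of c] by metis
    have "(\<Sum>j\<in>UNIV. m j * d i j) = 0" for i
    proof -
      have "(\<Sum>j\<in>UNIV. c j * of_int (d i j)) = 0"
        using arg_cong[OF c, of "\<lambda>v. v $ i"] by (simp add: A_def column_def)
      then have "of_int N * (\<Sum>j\<in>UNIV. c j * of_int (d i j)) = 0" by simp
      then have "of_int (\<Sum>j\<in>UNIV. m j * d i j) = (0 :: rat)"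
        by (simp add: sum_distrib_left mult.assoc[symmetric] N(2))
      then show ?thesis by (simp only: of_int_eq_0_iff)
    qed
    then have "m j = 0" using cols[of m] by simp
    then show "c j = 0" using N(1) N(2)[of j] by simp
  qed
  then obtain B where "B ** A = mat 1"
    using matrix_left_invertible_independent_columns[of A] by blast
  then have "A ** B = mat 1" by (simp add: matrix_left_right_inverse)
  then have rows: "\<forall>c. sum (\<lambda>i. c i *s row i A) UNIV = 0 \<longrightarrow> (\<forall>i. c i = 0)"
    using matrix_right_invertible_independent_rows[of A] by blast
  have "sum (\<lambda>i. of_int (b i) *s row i A) UNIV = 0"
  proof (rule vec_eq_iff[THEN iffD2], rule allI)
    fix j
    show "sum (\<lambda>i. of_int (b i) *s row i A) UNIV $ j = 0 $ j"
      using arg_cong[OF b[of j], of "of_int :: int \<Rightarrow> rat"] by (simp add: A_def row_def)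
  qed
  then have "of_int (b i) = (0 :: rat)" for i using rows[rule_format, of "\<lambda>i. of_int (b i)"] by simp
  then show ?thesis by auto
qed

text \<open>A rational basis chosen from \<open>S\<close> is indexed by \<open>'n\<close> and padded
  with zeros. The padded family still has no nonzero orthogonal vector, so it is independent, and
  hence nothing was padded.\<close>

lemma ex_independent_integer_family:
  fixes S :: "('n::finite \<Rightarrow> int) set"
  assumes S: "\<And>l. (\<And>\<alpha>. \<alpha> \<in> S \<Longrightarrow> (\<Sum>j\<in>UNIV. l j * \<alpha> j) = 0) \<Longrightarrow> l = 0"
  shows "\<exists>a. (\<forall>i::'n. a i \<in> S) \<and> (\<forall>b. (\<forall>j. (\<Sum>i\<in>UNIV. b i * a i j) = 0) \<longrightarrow> b = 0)"
proof -
  define v :: "('n \<Rightarrow> int) \<Rightarrow> rat^'n" where "v \<alpha> = (\<chi> j. of_int (\<alpha> j))" for \<alpha>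
  obtain B where B: "B \<subseteq> v ` S" "vec.independent B" "v ` S \<subseteq> vec.span B"
    using vec.maximal_independent_subset .
  have "finite B" "card B \<le> CARD('n)"
    using vec.independent_span_bound[of cart_basis B] B(2) finite_cart_basis
    by (auto simp: vec.span_Basis card_cart_basis)
  then obtain e :: "rat^'n \<Rightarrow> 'n" where e: "inj_on e B"
    using card_le_inj[of B "UNIV :: 'n set"] by auto
  \<comment> \<open>Indices outside the image of \<open>e\<close> receive the default 0, which need
    not lie in \<open>S\<close>.\<close>
  define a where "a i = (if i \<in> e ` B then inv_into S v (inv_into B e i) else 0)" for i
  have a_e: "v (a (e x)) = x" if "x \<in> B" for x
    using that B(1) e by (auto simp: a_def f_inv_into_f subsetD)
  have indep: "b = 0" if b: "\<And>j. (\<Sum>i\<in>UNIV. b i * a i j) = 0" for b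
  proof (rule int_square_rows_independent[OF _ b])
    fix l assume l: "\<And>i. (\<Sum>j\<in>UNIV. l j * a i j) = 0"
    define U :: "(rat^'n) set" where "U = {x. (\<Sum>j\<in>UNIV. of_int (l j) * x $ j) = 0}"
    have lv: "(\<Sum>j\<in>UNIV. of_int (l j) * v \<alpha> $ j) = of_int (\<Sum>j\<in>UNIV. l j * \<alpha> j)" for \<alpha>
      by (simp add: v_def)
    have "vec.subspace U"
      by (auto simp: vec.subspace_def U_def distrib_left sum.distrib mult.left_commute
          simp flip: sum_distrib_left)
    moreover have "B \<subseteq> U"
    proof
      fix x assume "x \<in> B"
      then show "x \<in> U" using lv[of "a (e x)"] l[of "e x"] by (simp add: U_def a_e)
    qed
    ultimately have "v ` S \<subseteq> U" using B(3) vec.span_minimal by blast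
    then show "l = 0"
      by (intro S) (auto simp: U_def lv image_subset_iff simp del: of_int_sum of_int_mult)
  qed
  have "a i \<in> S" for i
  proof (cases "i \<in> e ` B")
    case True
    then have "inv_into B e i \<in> B" by (rule inv_into_into)
    then have "inv_into B e i \<in> v ` S" using B(1) by auto
    with True show ?thesis by (simp add: a_def inv_into_into)
  next
    case False
    \<comment> \<open>At a padded index the unit vector is a relation, contradicting
      independence.\<close>
    have "(\<lambda>j. if j = i then 1 else 0 :: int) = 0"
      by (rule indep) (simp add: if_distrib[of "\<lambda>x. x * _"] a_def False cong: if_cong)
    from fun_cong[OF this, of i] show ?thesis by simp
  qed
  with indep show ?thesis by blast
qed

section \<open>Torus characters\<close>

text \<open>Otherwise every nonzero element would be a root of \<open>monom 1 ?m - 1\<close>, which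
  has finitely many roots.\<close>

lemma ex_powi_neq_1:
  assumes "k \<noteq> 0"
  shows "\<exists>s :: 'k::alg_closed_field. s \<noteq> 0 \<and> s powi k \<noteq> 1"
proof (rule ccontr)
  assume *: "\<not> ?thesis"
  let ?m = "nat \<bar>k\<bar>"
  have m: "?m > 0" using assms by simp
  have "s = 0 \<or> s ^ ?m = 1" for s :: 'k
    using * by (cases "k \<ge> 0") (auto simp: power_int_def power_inverse)
  then have "(UNIV :: 'k set) \<subseteq> insert 0 {s. poly (monom 1 ?m - 1) s = 0}"
    by (auto simp: poly_monom)
  moreover have "monom 1 ?m - 1 \<noteq> (0 :: 'k poly)"
  proof
    assume "monom 1 ?m - 1 = (0 :: 'k poly)"
    then have "coeff (monom 1 ?m - 1 :: 'k poly) ?m = 0" by simp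
    with m show False by (simp add: coeff_monom one_poly_eq_simps coeff_pCons split: nat.splits)
  qed
  ultimately show False
    using poly_roots_finite infinite_UNIV_alg_closed finite_subset by (metis finite_insert)
qed

lemma one_in_torus [simp]: "1 \<in> torus"
  by (simp add: torus_def)

lemma times_in_torus [simp]: "t \<in> torus \<Longrightarrow> u \<in> torus \<Longrightarrow> t * u \<in> torus"
  by (simp add: torus_def)

lemma torus_character_one [simp]: "torus_character \<alpha> 1 = 1"
  by (simp add: torus_character_def)

lemma torus_character_mult:
  "torus_character \<alpha> (t * u) = torus_character \<alpha> t * torus_character \<alpha> u"
  by (simp add: torus_character_def power_int_mult_distrib prod.distrib)

text \<open>The exponent is the pairing of \<open>l\<close> with \<open>\<alpha>\<close>. A vector
  orthogonal to given weights thus yields torus elements on which their characters are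
  trivial.\<close>

lemma torus_character_one_parameter:
  assumes "s \<noteq> 0"
  shows "torus_character \<alpha> (\<lambda>i. s powi l i) = s powi (\<Sum>i\<in>UNIV. l i * \<alpha> i)"
proof -
  have "(\<Prod>i\<in>A. s powi (l i * \<alpha> i)) = s powi (\<Sum>i\<in>A. l i * \<alpha> i)" if "finite A" for A
    using that by induction (simp_all add: power_int_add assms)
  then show ?thesis by (simp add: torus_character_def power_int_mult)
qed

lemma ex_torus_character_neq:
  fixes \<alpha> \<beta> :: "'r::finite \<Rightarrow> int"
  assumes "\<alpha> \<noteq> \<beta>"
  shows "\<exists>t \<in> torus. torus_character \<alpha> t \<noteq> (torus_character \<beta> t :: 'k::alg_closed_field)"
proof -
  obtain i where i: "\<alpha> i - \<beta> i \<noteq> 0" using assms by auto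
  obtain s :: 'k where s: "s \<noteq> 0" "s powi (\<alpha> i - \<beta> i) \<noteq> 1" using ex_powi_neq_1[OF i] by blast
  let ?l = "\<lambda>j. if j = i then 1 else 0 :: int"
  have "torus_character \<gamma> (\<lambda>j. s powi ?l j) = s powi \<gamma> i" for \<gamma>
    by (simp only: torus_character_one_parameter[OF s(1)])
      (simp add: if_distrib[of "\<lambda>x. x * _"] cong: if_cong)
  then show ?thesis
    using s by (intro bexI[of _ "\<lambda>j. s powi ?l j"]) (auto simp: torus_def power_int_diff)
qed

text \<open>Dedekind's argument: from the relation at \<open>t * u\<close> subtract the one at
  \<open>t\<close> times the value of \<open>\<beta>\<close> at \<open>u\<close>. This eliminates
  \<open>\<beta>\<close>, and \<open>u\<close> is chosen to separate \<open>\<gamma>\<close> from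
  \<open>\<beta>\<close>.\<close>

lemma torus_characters_independent:
  fixes x :: "('r::finite \<Rightarrow> int) \<Rightarrow> 'k::alg_closed_field"
  assumes "finite A" "\<And>t. t \<in> torus \<Longrightarrow> (\<Sum>\<alpha>\<in>A. torus_character \<alpha> t * x \<alpha>) = 0" "\<alpha> \<in> A"
  shows "x \<alpha> = 0"
  using assms
proof (induction A arbitrary: x \<alpha>)
  case (insert \<beta> A)
  have IH: "x \<gamma> = 0" if \<gamma>: "\<gamma> \<in> A" for \<gamma>
  proof -
    have "\<gamma> \<noteq> \<beta>" using \<gamma> insert by blast
    then obtain u :: "'r \<Rightarrow> 'k" where u: "u \<in> torus" "torus_character \<gamma> u \<noteq> torus_character \<beta> u"
      using ex_torus_character_neq by blast
    have "(torus_character \<gamma> u - torus_character \<beta> u) * x \<gamma> = 0"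
    proof (rule insert.IH[OF _ \<gamma>])
      fix t :: "'r \<Rightarrow> 'k" assume t: "t \<in> torus"
      have "(\<Sum>\<alpha>\<in>insert \<beta> A. torus_character \<alpha> (t * u) * x \<alpha>)
          - torus_character \<beta> u * (\<Sum>\<alpha>\<in>insert \<beta> A. torus_character \<alpha> t * x \<alpha>) = 0"
        by (simp only: insert.prems(1)[OF times_in_torus[OF t u(1)]] insert.prems(1)[OF t]) simp
      then show "(\<Sum>\<alpha>\<in>A. torus_character \<alpha> t *
          ((torus_character \<alpha> u - torus_character \<beta> u) * x \<alpha>)) = 0"
        using insert.hyps
        by (simp add: torus_character_mult sum_distrib_left algebra_simps sum_subtractf)
    qed
    with u(2) show ?thesis by simp
  qed
  have "x \<beta> = 0" using insert.prems(1)[OF one_in_torus] insert.hyps IH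
    by (simp add: torus_character_def)
  with IH insert.prems(2) show ?case by auto
qed simp

lemma torus_characters_independent_free:
  fixes x :: "('r::finite \<Rightarrow> int) \<Rightarrow> ('n, 'k::alg_closed_field) free_algebra"
  assumes "finite A"
    and "\<And>t. t \<in> torus \<Longrightarrow> (\<Sum>\<alpha>\<in>A. free_scale (torus_character \<alpha> t) (x \<alpha>)) = 0" and "\<alpha> \<in> A"
  shows "x \<alpha> = 0"
proof (rule poly_mapping_eqI)
  fix w
  have "Poly_Mapping.lookup (x \<alpha>) w = 0"
  proof (rule torus_characters_independent[OF assms(1) _ assms(3)])
    fix t :: "'r \<Rightarrow> 'k" assume "t \<in> torus"
    from arg_cong[OF assms(2)[OF this], of "\<lambda>f. Poly_Mapping.lookup f w"]
    show "(\<Sum>\<alpha>\<in>A. torus_character \<alpha> t * Poly_Mapping.lookup (x \<alpha>) w) = 0"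
      by (simp add: lookup_sum)
  qed
  then show "Poly_Mapping.lookup (x \<alpha>) w = Poly_Mapping.lookup 0 w" by simp
qed

section \<open>The grading defined by a torus action\<close>

lemma torus_character_add:
  "t \<in> torus \<Longrightarrow> torus_character (\<alpha> + \<beta>) t = torus_character \<alpha> t * torus_character \<beta> t"
  by (simp add: torus_character_def torus_def power_int_add prod.distrib)

lemma torus_character_0 [simp]: "torus_character 0 t = 1"
  by (simp add: torus_character_def)

locale free_torus_action =
  fixes \<sigma> :: "('n, 'k::alg_closed_field) free_algebra \<Rightarrow> ('r::finite, ('n, 'k) free_algebra) laurent"
  assumes regular: "regular_action free_scale \<sigma>"
begin

sublocale \<sigma>: algebra_hom free_scale "coeff_scale free_scale" \<sigma>
  using regular by (simp add: regular_action_def)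

definition component ::
  "('r \<Rightarrow> int) \<Rightarrow> ('n, 'k) free_algebra \<Rightarrow> ('n, 'k) free_algebra" where
  "component \<alpha> f = Poly_Mapping.lookup (\<sigma> f) \<alpha>"

text \<open>Separating the substitution of \<open>t\<close> from \<open>\<sigma>\<close> allows
  multiplicativity to be checked on monomials.\<close>

definition eval_laurent ::
  "('r \<Rightarrow> 'k) \<Rightarrow> ('r, ('n, 'k) free_algebra) laurent \<Rightarrow> ('n, 'k) free_algebra" where
  "eval_laurent t h =
     (\<Sum>\<alpha>\<in>Poly_Mapping.keys h. free_scale (torus_character \<alpha> t) (Poly_Mapping.lookup h \<alpha>))"

abbreviation act :: "('r \<Rightarrow> 'k) \<Rightarrow> ('n, 'k) free_algebra \<Rightarrow> ('n, 'k) free_algebra" where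
  "act \<equiv> specialize free_scale \<sigma>"

lemma act_eq_eval: "act t f = eval_laurent t (\<sigma> f)"
  by (simp add: specialize_def eval_laurent_def)

lemma eval_laurent_superset:
  assumes "finite A" "Poly_Mapping.keys h \<subseteq> A"
  shows "eval_laurent t h =
    (\<Sum>\<alpha>\<in>A. free_scale (torus_character \<alpha> t) (Poly_Mapping.lookup h \<alpha>))"
  unfolding eval_laurent_def
  by (rule sum.mono_neutral_left) (use assms in \<open>auto simp: in_keys_iff\<close>)

lemma eval_laurent_add: "eval_laurent t (g + h) = eval_laurent t g + eval_laurent t h"
proof -
  let ?A = "Poly_Mapping.keys g \<union> Poly_Mapping.keys h"
  have "Poly_Mapping.keys (g + h) \<subseteq> ?A" by (rule Poly_Mapping.keys_add)
  then show ?thesis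
    by (simp add: eval_laurent_superset[of ?A] lookup_add free_algebra.scale_right_distrib sum.distrib)
qed

lemma eval_laurent_single:
  "eval_laurent t (Poly_Mapping.single \<alpha> f) = free_scale (torus_character \<alpha> t) f"
  by (subst eval_laurent_superset[of "{\<alpha>}"]) (auto split: if_splits)

lemma eval_laurent_mult:
  assumes t: "t \<in> torus"
  shows "eval_laurent t (g * h) = eval_laurent t g * eval_laurent t h"
proof (induction g rule: poly_mapping_monomial_induct)
  case (single \<alpha> f)
  show ?case
  proof (induction h rule: poly_mapping_monomial_induct)
    case (single \<beta> f')
    then show ?case
      by (simp add: mult_single eval_laurent_single torus_character_add[OF t]
          free_algebra.scale_mult_left free_algebra.scale_mult_right)
  qed (simp add: distrib_left eval_laurent_add)
qed (simp add: distrib_right eval_laurent_add)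

lemma act_expand:
  assumes "finite A" "\<And>\<alpha>. component \<alpha> f \<noteq> 0 \<Longrightarrow> \<alpha> \<in> A"
  shows "act t f = (\<Sum>\<alpha>\<in>A. free_scale (torus_character \<alpha> t) (component \<alpha> f))"
  unfolding act_eq_eval component_def
  by (rule eval_laurent_superset) (use assms in \<open>auto simp: component_def in_keys_iff\<close>)

lemma finite_component: "finite {\<alpha>. component \<alpha> f \<noteq> 0}"
  by (simp add: component_def)

lemma component_add: "component \<alpha> (f + g) = component \<alpha> f + component \<alpha> g"
  by (simp add: component_def \<sigma>.add lookup_add)

lemma component_scale: "component \<alpha> (free_scale c f) = free_scale c (component \<alpha> f)"
  by (simp add: component_def \<sigma>.scale free_algebra.lookup_coeff_scale)

lemma algebra_hom_act:
  assumes t: "t \<in> torus"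
  shows "algebra_hom free_scale free_scale (act t)"
proof (rule algebra_homI)
  show "act t (free_scale c x) = free_scale c (act t x)" for c x
  proof -
    have "act t (free_scale c x) = (\<Sum>\<alpha> | component \<alpha> x \<noteq> 0.
        free_scale (torus_character \<alpha> t) (component \<alpha> (free_scale c x)))"
      by (rule act_expand) (auto simp: finite_component component_scale)
    also have "\<dots> = free_scale c (\<Sum>\<alpha> | component \<alpha> x \<noteq> 0.
        free_scale (torus_character \<alpha> t) (component \<alpha> x))"
      by (simp add: component_scale free_algebra.scale_sum_right mult.commute)
    also have "\<dots> = free_scale c (act t x)"
      by (subst act_expand[symmetric]) (auto simp: finite_component)
    finally show ?thesis .
  qed
  show "act t 1 = 1"
    using eval_laurent_single[of t 0 1] by (simp add: act_eq_eval \<sigma>.hom_one)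
qed (simp_all add: act_eq_eval \<sigma>.add \<sigma>.hom_mult eval_laurent_add eval_laurent_mult t
    free_algebra.assoc_algebra_axioms)

lemma act_one: "act 1 f = f"
  using regular by (simp add: regular_action_def)

lemma act_act: "t \<in> torus \<Longrightarrow> u \<in> torus \<Longrightarrow> act t (act u f) = act (t * u) f"
  using regular unfolding regular_action_def by (metis comp_apply)

text \<open>Fix \<open>t\<close> and expand both sides of the action law for \<open>t\<close> and
  \<open>u\<close> as sums of characters of \<open>u\<close>; independence equates the
  coefficients.\<close>

lemma act_component:
  assumes t: "t \<in> torus"
  shows "act t (component \<alpha> f) = free_scale (torus_character \<alpha> t) (component \<alpha> f)"
proof -
  interpret t: algebra_hom free_scale free_scale "act t" by (rule algebra_hom_act[OF t])
  let ?A = "insert \<alpha> {\<beta>. component \<beta> f \<noteq> 0}"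
  have "act t (component \<alpha> f) - free_scale (torus_character \<alpha> t) (component \<alpha> f) = 0"
  proof (rule torus_characters_independent_free[of ?A])
    fix u :: "'r \<Rightarrow> 'k" assume u: "u \<in> torus"
    have "act t (act u f) = (\<Sum>\<beta>\<in>?A. free_scale (torus_character \<beta> u) (act t (component \<beta> f)))"
      by (subst act_expand[of ?A f u]) (auto simp: finite_component t.sum t.scale)
    moreover have "act (t * u) f =
        (\<Sum>\<beta>\<in>?A. free_scale (torus_character \<beta> u) (free_scale (torus_character \<beta> t) (component \<beta> f)))"
      by (subst act_expand[of ?A f]) (auto simp: finite_component torus_character_mult mult.commute)
    ultimately show "(\<Sum>\<beta>\<in>?A. free_scale (torus_character \<beta> u)
        (act t (component \<beta> f) - free_scale (torus_character \<beta> t) (component \<beta> f))) = 0"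
      using act_act[OF t u] by (simp add: free_algebra.scale_right_diff_distrib sum_subtractf)
  qed (simp_all add: finite_component)
  then show ?thesis by simp
qed

text \<open>The action on a component is a single character by \<open>act_component\<close>, but
  also the sum over its own components; independence compares the two.\<close>

lemma component_component: "component \<beta> (component \<alpha> f) = (if \<beta> = \<alpha> then component \<beta> f else 0)"
proof -
  let ?g = "component \<alpha> f"
  let ?A = "insert \<alpha> (insert \<beta> {\<gamma>. component \<gamma> ?g \<noteq> 0})"
  have "component \<beta> ?g - (if \<beta> = \<alpha> then ?g else 0) = 0"
  proof (rule torus_characters_independent_free[of ?A
        "\<lambda>\<gamma>. component \<gamma> ?g - (if \<gamma> = \<alpha> then ?g else 0)"])
    show fin: "finite ?A" by (simp add: finite_component)
    fix t :: "'r \<Rightarrow> 'k" assume t: "t \<in> torus"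
    have "(\<Sum>\<gamma>\<in>?A. free_scale (torus_character \<gamma> t) (component \<gamma> ?g)) = act t ?g"
      by (rule act_expand[symmetric]) (auto simp: finite_component)
    moreover have "(\<Sum>\<gamma>\<in>?A. free_scale (torus_character \<gamma> t) (if \<gamma> = \<alpha> then ?g else 0)) =
        (\<Sum>\<gamma>\<in>?A. if \<gamma> = \<alpha> then free_scale (torus_character \<alpha> t) ?g else 0)"
      by (rule sum.cong) auto
    then have "(\<Sum>\<gamma>\<in>?A. free_scale (torus_character \<gamma> t) (if \<gamma> = \<alpha> then ?g else 0)) =
        free_scale (torus_character \<alpha> t) ?g"
      using fin by (simp only: sum.delta) simp
    ultimately show "(\<Sum>\<gamma>\<in>?A. free_scale (torus_character \<gamma> t)
        (component \<gamma> ?g - (if \<gamma> = \<alpha> then ?g else 0))) = 0"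
      using act_component[OF t]
      by (simp only: free_algebra.scale_right_diff_distrib sum_subtractf) simp
  qed simp
  then show ?thesis by (simp split: if_splits)
qed

lemma \<sigma>_component: "\<sigma> (component \<alpha> f) = Poly_Mapping.single \<alpha> (component \<alpha> f)"
  by (rule poly_mapping_eqI)
    (use component_component in \<open>auto simp: component_def lookup_single when_def\<close>)

sublocale algebra_grading free_scale component
proof
  fix \<alpha> \<beta> x y
  show "(\<Sum>\<alpha> | component \<alpha> x \<noteq> 0. component \<alpha> x) = x"
    \<comment> \<open>At the identity of the torus all characters are 1, so the expansion is the sum
      of the components.\<close>
    using act_expand[of "{\<alpha>. component \<alpha> x \<noteq> 0}" x 1] finite_component
    by (simp add: act_one torus_character_one del: one_fun_def)
  show "component (\<alpha> + \<beta>) (component \<alpha> x * component \<beta> y) = component \<alpha> x * component \<beta> y"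
    unfolding component_def[of "\<alpha> + \<beta>"]
    by (simp add: \<sigma>.hom_mult \<sigma>_component mult_single)
  have "component 0 1 = Poly_Mapping.lookup (Poly_Mapping.single 0 1) (0 :: 'r \<Rightarrow> int)"
    by (simp only: component_def \<sigma>.hom_one single_one)
  then show "component 0 1 = 1" by simp
qed (simp_all add: component_add component_scale component_component finite_component)

lemma act_homogeneous:
  "t \<in> torus \<Longrightarrow> homogeneous \<alpha> f \<Longrightarrow> act t f = free_scale (torus_character \<alpha> t) f"
  unfolding homogeneous_def by (metis act_component)

text \<open>Composing a point with a torus element gives another point, where the sum vanishes as
  well. Varying the torus element gives a relation between distinct characters.\<close>

lemma vanishing_homogeneous_summand:
  assumes I: "finite I" "inj_on wt I" "\<And>i. i \<in> I \<Longrightarrow> homogeneous (wt i) (x i)"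
    and vanishing: "vanishing (\<Sum>i\<in>I. x i)" and i: "i \<in> I"
  shows "vanishing (x i)"
  unfolding vanishing_def
proof
  fix a
  define y where "y \<alpha> = ev a (x (inv_into I wt \<alpha>))" for \<alpha>
  have "y (wt i) = 0"
  proof (rule torus_characters_independent[of "wt ` I"])
    fix t :: "'r \<Rightarrow> 'k" assume t: "t \<in> torus"
    interpret t: algebra_hom free_scale free_scale "act t" by (rule algebra_hom_act[OF t])
    obtain b where b: "ev a \<circ> act t = ev b"
      using algebra_hom_eq_ev algebra_hom_comp[OF t.algebra_hom_axioms ev.algebra_hom_axioms] by blast
    have "(\<Sum>\<alpha>\<in>wt ` I. torus_character \<alpha> t * y \<alpha>) = (\<Sum>i\<in>I. torus_character (wt i) t * ev a (x i))"
      using I(2) by (simp add: sum.reindex y_def)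
    also have "\<dots> = (ev a \<circ> act t) (\<Sum>i\<in>I. x i)"
      using act_homogeneous[OF t I(3)] by (simp add: t.sum ev.sum ev.scale)
    also have "\<dots> = 0"
      using vanishing by (simp only: b vanishing_def)
    finally show "(\<Sum>\<alpha>\<in>wt ` I. torus_character \<alpha> t * y \<alpha>) = 0" .
  qed (use I i in auto)
  then show "ev a (x i) = 0" using I i by (simp add: y_def)
qed

section \<open>Weights occurring among functions on points\<close>

lemma subspace_vanishing: "free_algebra.subspace {f. vanishing f}"
  by (simp add: free_algebra.subspace_def vanishing_def ev.zero ev.add ev.scale)

definition point_weights :: "('r \<Rightarrow> int) set" where
  "point_weights = {\<alpha>. \<exists>f. homogeneous \<alpha> f \<and> \<not> vanishing f}"

text \<open>If \<open>t\<close> acts trivially on functions on points, it moves generators only by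
  vanishing elements, which lie in \<open>aug 2\<close>. Being unipotent, it has only the eigenvalue
  1, also on components that vanish at all points.\<close>

lemma effective_on_points:
  fixes t :: "'r \<Rightarrow> 'k"
  assumes eff: "effective free_scale \<sigma>" and t: "t \<in> torus" "t \<noteq> 1"
  shows "\<exists>\<alpha>\<in>point_weights. torus_character \<alpha> t \<noteq> 1"
proof (rule ccontr)
  assume *: "\<not> ?thesis"
  interpret t: algebra_hom free_scale free_scale "act t" by (rule algebra_hom_act[OF t(1)])
  have diff: "act t f - f = (\<Sum>\<alpha> | component \<alpha> f \<noteq> 0.
      free_scale (torus_character \<alpha> t - 1) (component \<alpha> f))" for f
  proof -
    have "act t f - f = (\<Sum>\<alpha> | component \<alpha> f \<noteq> 0. free_scale (torus_character \<alpha> t) (component \<alpha> f)) -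
        (\<Sum>\<alpha> | component \<alpha> f \<noteq> 0. component \<alpha> f)"
      by (subst act_expand[OF finite_component[of f]]) (auto simp: sum_p)
    then show ?thesis by (simp add: free_algebra.scale_left_diff_distrib sum_subtractf)
  qed
  interpret t: unipotent_endo "act t"
  proof
    fix i
    have "free_scale (torus_character \<alpha> t - 1) (component \<alpha> (gen i)) \<in> {f. vanishing f}" for \<alpha>
    proof (cases "vanishing (component \<alpha> (gen i))")
      case True
      then show ?thesis by (simp add: vanishing_def ev.scale)
    next
      case False
      then have "\<alpha> \<in> point_weights" unfolding point_weights_def using homogeneous_p by blast
      with * show ?thesis by (simp add: vanishing_def ev.zero)
    qed
    then have "act t (gen i) - gen i \<in> {f. vanishing f}"
      unfolding diff by (intro free_algebra.subspace_sum subspace_vanishing)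
    then show "act t (gen i) - gen i \<in> aug 2" by (simp add: aug_2_if_vanishing)
  qed
  have "torus_character \<alpha> t = 1" if "component \<alpha> f \<noteq> 0" for \<alpha> f
    using t.eigenvalue_eq_1[OF act_component[OF t(1)] that] .
  then have "act t f - f = 0" for f
    unfolding diff by (intro sum.neutral) simp
  then have "act t = id" by auto
  with eff t show False by (auto simp: effective_def)
qed

text \<open>A nonzero \<open>l\<close> would define a one-parameter subgroup with a nontrivial
  element on which all these characters are 1.\<close>

lemma point_weights_not_orthogonal:
  assumes "effective free_scale \<sigma>"
    and "\<And>\<alpha>. \<alpha> \<in> point_weights \<Longrightarrow> (\<Sum>j\<in>UNIV. l j * \<alpha> j) = 0"
  shows "l = 0"
proof (rule ccontr)
  assume "l \<noteq> 0"
  then obtain i where "l i \<noteq> 0" by (auto simp: fun_eq_iff)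
  then obtain s :: 'k where s: "s \<noteq> 0" "s powi l i \<noteq> 1" using ex_powi_neq_1 by blast
  let ?t = "\<lambda>j. s powi l j"
  have "?t \<noteq> 1" using s(2) by (auto simp: fun_eq_iff)
  moreover have "?t \<in> torus" using s(1) by (simp add: torus_def)
  ultimately obtain \<alpha> where "\<alpha> \<in> point_weights" "torus_character \<alpha> ?t \<noteq> 1"
    using effective_on_points[OF assms(1)] by blast
  then show False using assms(2) s(1) by (simp add: torus_character_one_parameter)
qed

end

section \<open>Counting monomials\<close>

text \<open>The relation is indexed by \<open>J\<close>, so a repeated vector already gives one,
  with coefficients 1 and -1.\<close>

lemma (in vector_space) ex_linear_relation:
  assumes J: "finite J" and P: "finite P" "v ` J \<subseteq> span P" "card P < card J"
  shows "\<exists>c. (\<exists>j\<in>J. c j \<noteq> 0) \<and> (\<Sum>j\<in>J. scale (c j) (v j)) = 0"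
proof (cases "inj_on v J")
  case True
  have "dependent (v ` J)"
    using independent_span_bound[OF P(1) _ P(2)] P(3) card_image[OF True] by auto
  then obtain u where u: "\<exists>x\<in>v ` J. u x \<noteq> 0" "(\<Sum>x\<in>v ` J. scale (u x) x) = 0"
    using dependent_finite[of "v ` J"] J by blast
  then show ?thesis
    by (intro exI[of _ "u \<circ> v"]) (simp add: sum.reindex[OF True])
next
  case False
  then obtain i j where ij: "i \<in> J" "j \<in> J" "v i = v j" "i \<noteq> j" by (auto simp: inj_on_def)
  define c :: "'c \<Rightarrow> 'a" where "c k = (if k = i then 1 else 0) - (if k = j then 1 else 0)" for k
  have "(\<Sum>k\<in>J. scale (c k) (v k)) =
      (\<Sum>k\<in>J. if k = i then v i else 0) - (\<Sum>k\<in>J. if k = j then v j else 0)"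
    unfolding sum_subtractf[symmetric]
    by (intro sum.cong refl) (auto simp: c_def)
  also have "\<dots> = 0" using ij J by simp
  finally show ?thesis using ij by (intro exI[of _ c]) (auto simp: c_def intro!: bexI[of _ i])
qed

section \<open>Upper bounds on word length and the relations they force\<close>

definition length_bounded :: "nat \<Rightarrow> ('n, 'k::field) free_algebra \<Rightarrow> bool" where
  "length_bounded m f \<longleftrightarrow> (\<forall>w\<in>Poly_Mapping.keys f. length w \<le> m)"

lemma length_bounded_mono: "length_bounded l f \<Longrightarrow> l \<le> m \<Longrightarrow> length_bounded m f"
  by (auto simp: length_bounded_def)

lemma length_bounded_mult:
  assumes "length_bounded l f" "length_bounded m g"
  shows "length_bounded (l + m) (f * g)"
  unfolding length_bounded_def
proof
  fix w assume "w \<in> Poly_Mapping.keys (f * g)"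
  then obtain u v where "u \<in> Poly_Mapping.keys f" "v \<in> Poly_Mapping.keys g" "w = u + v"
    using keys_mult by blast
  with assms show "length w \<le> l + m"
    by (auto simp: length_bounded_def plus_list_def add_mono)
qed

lemma length_bounded_one: "length_bounded 0 1"
  by (simp add: length_bounded_def zero_list_def flip: single_one)

lemma length_bounded_power: "length_bounded m f \<Longrightarrow> length_bounded (e * m) (f ^ e)"
  by (induction e) (simp_all add: length_bounded_one length_bounded_mult)

lemma length_bounded_prod_list:
  assumes "\<And>x. x \<in> set xs \<Longrightarrow> length_bounded m x"
  shows "length_bounded (length xs * m) (prod_list xs)"
  using assms by (induction xs) (simp_all add: length_bounded_one length_bounded_mult)

lemma ex_length_bounded: "\<exists>m. length_bounded m f"
  by (intro exI[of _ "\<Sum>w\<in>Poly_Mapping.keys f. length w"])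
    (auto simp: length_bounded_def intro: member_le_sum)

lemma prod_list_map_eq_prod_count:
  fixes a :: "'n::finite \<Rightarrow> 'k::comm_monoid_mult"
  shows "prod_list (map a w) = (\<Prod>i\<in>UNIV. a i ^ count_list w i)"
proof (induction w)
  case (Cons j w)
  have "(\<Prod>i\<in>UNIV. a i ^ count_list (j # w) i) =
      (\<Prod>i\<in>UNIV. (if i = j then a j else 1) * a i ^ count_list w i)"
    by (intro prod.cong refl) auto
  also have "\<dots> = a j * (\<Prod>i\<in>UNIV. a i ^ count_list w i)"
    by (simp add: prod.distrib)
  finally show ?case using Cons by simp
qed simp

lemma sum_list_map_eq_sum_count_int:
  fixes a :: "'n::finite \<Rightarrow> int"
  shows "sum_list (map a w) = (\<Sum>i\<in>UNIV. int (count_list w i) * a i)"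
proof (induction w)
  case (Cons j w)
  have "(\<Sum>i\<in>UNIV. int (count_list (j # w) i) * a i) =
      (\<Sum>i\<in>UNIV. (if i = j then a j else 0) + int (count_list w i) * a i)"
    by (intro sum.cong refl) (auto simp: algebra_simps)
  also have "\<dots> = a j + (\<Sum>i\<in>UNIV. int (count_list w i) * a i)"
    by (simp add: sum.distrib)
  finally show ?case using Cons by simp
qed simp

lemma sum_list_fun_apply: "sum_list (map d w) j = sum_list (map (\<lambda>i. d i j) w)"
  by (induction w) simp_all

text \<open>Words of length at most \<open>M\<close> give at most \<open>(M + 1)\<^sup>n\<close> distinct functions on points.\<close>

lemma ex_relation_on_points:
  fixes h :: "'j \<Rightarrow> ('n::finite, 'k::field) free_algebra"
  assumes J: "finite J" "\<And>j. j \<in> J \<Longrightarrow> length_bounded M (h j)"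
    and card: "(M + 1) ^ CARD('n) < card J"
  shows "\<exists>c. (\<exists>j\<in>J. c j \<noteq> 0) \<and> vanishing (\<Sum>j\<in>J. free_scale (c j) (h j))"
proof -
  define s where "s = (\<lambda>(c :: 'k) (f :: ('n \<Rightarrow> 'k) \<Rightarrow> 'k) a. c * f a)"
  interpret s: vector_space s
    by standard (auto simp: s_def fun_eq_iff algebra_simps)
  define mon :: "('n \<Rightarrow> nat) \<Rightarrow> ('n \<Rightarrow> 'k) \<Rightarrow> 'k" where "mon e a = (\<Prod>i\<in>UNIV. a i ^ e i)" for e a
  define E :: "('n \<Rightarrow> nat) set" where "E = PiE UNIV (\<lambda>_. {..M})"
  have sum_apply: "sum f A a = (\<Sum>x\<in>A. f x a)" for f :: "'x \<Rightarrow> ('n \<Rightarrow> 'k) \<Rightarrow> 'k" and A a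
    by (induction A rule: infinite_finite_induct) auto
  have "\<exists>c. (\<exists>j\<in>J. c j \<noteq> 0) \<and> (\<Sum>j\<in>J. s (c j) (\<lambda>a. ev a (h j))) = 0"
  proof (rule s.ex_linear_relation[OF J(1)])
    have "finite E" "card E = (M + 1) ^ CARD('n)"
      by (simp_all add: E_def finite_PiE card_PiE)
    then show "finite (mon ` E)" "card (mon ` E) < card J"
      using card_image_le[of E mon] card by simp_all
    have "(\<lambda>a. ev a (h j)) \<in> s.span (mon ` E)" if j: "j \<in> J" for j
    proof -
      have "(\<lambda>a. ev a (h j)) =
          (\<Sum>w\<in>Poly_Mapping.keys (h j). s (Poly_Mapping.lookup (h j) w) (mon (count_list w)))"
        by (rule ext) (simp add: sum_apply s_def mon_def ev_def free_lift_def prod_list_map_eq_prod_count)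
      also have "\<dots> \<in> s.span (mon ` E)"
      proof (intro s.span_sum s.span_scale s.span_base imageI)
        fix w assume "w \<in> Poly_Mapping.keys (h j)"
        then have "length w \<le> M" using J(2)[OF j] by (simp add: length_bounded_def)
        then have "count_list w i \<le> M" for i using count_le_length[of w i] by linarith
        then show "count_list w \<in> E" by (simp add: E_def PiE_iff)
      qed
      finally show ?thesis .
    qed
    then show "(\<lambda>j a. ev a (h j)) ` J \<subseteq> s.span (mon ` E)" by blast
  qed
  then obtain c where c: "\<exists>j\<in>J. c j \<noteq> 0" "(\<Sum>j\<in>J. s (c j) (\<lambda>a. ev a (h j))) = 0" by blast
  have "ev a (\<Sum>j\<in>J. free_scale (c j) (h j)) = 0" for a
    using fun_cong[OF c(2), of a] by (simp add: sum_apply s_def ev.sum ev.scale)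
  with c(1) show ?thesis by (auto simp: vanishing_def)
qed

lemma not_vanishing_one: "\<not> vanishing 1"
  by (simp add: vanishing_def ev.hom_one)

lemma not_vanishing_power:
  fixes f :: "('n, 'k::alg_closed_field) free_algebra"
  shows "\<not> vanishing f \<Longrightarrow> \<not> vanishing (f ^ e)"
  by (induction e) (auto simp: not_vanishing_one dest: vanishing_mult_cancel)

lemma not_vanishing_prod_list:
  fixes xs :: "('n, 'k::alg_closed_field) free_algebra list"
  shows "(\<And>x. x \<in> set xs \<Longrightarrow> \<not> vanishing x) \<Longrightarrow> \<not> vanishing (prod_list xs)"
  by (induction xs) (auto simp: not_vanishing_one dest: vanishing_mult_cancel)

text \<open>Since \<open>f\<close> takes every value, a polynomial relation for \<open>f\<close> on
  points is a one-variable polynomial with every scalar as a root.\<close>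

lemma vanishing_polynomial_relation:
  fixes f :: "('n, 'k::alg_closed_field) free_algebra"
  assumes f: "ev a f \<noteq> ev b f" and rel: "vanishing (\<Sum>j\<le>N. free_scale (c j) (f ^ j))" and "j \<le> N"
  shows "c j = 0"
proof -
  define q where "q = (\<Sum>j\<le>N. monom (c j) j)"
  have "poly q y = 0" for y
  proof -
    obtain x where "ev x f = y" using ev_surj_if_nonconst[OF f] by blast
    moreover have "ev x (\<Sum>j\<le>N. free_scale (c j) (f ^ j)) = 0" using rel by (simp add: vanishing_def)
    ultimately show ?thesis by (simp add: q_def poly_sum poly_monom ev.sum ev.scale ev.hom_power)
  qed
  then have "{y. poly q y = 0} = UNIV" by auto
  then have "q = 0" using poly_roots_finite[of q] infinite_UNIV_alg_closed by metis
  then have "coeff q j = 0" by simp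
  with \<open>j \<le> N\<close> show ?thesis by (simp add: q_def coeff_sum)
qed

section \<open>Effective actions of the maximal torus\<close>

text \<open>Generators and torus coordinates share the index type \<open>'n\<close>, so the weight
  matrices below are square.\<close>

locale maximal_torus_action = free_torus_action \<sigma>
  for \<sigma> :: "('n::finite, 'k::alg_closed_field) free_algebra \<Rightarrow> ('n, ('n, 'k) free_algebra) laurent" +
  assumes effective: "effective free_scale \<sigma>"
begin

lemma homogeneous_power:
  assumes "homogeneous \<alpha> x"
  shows "homogeneous (\<lambda>k. int e * \<alpha> k) (x ^ e)"
proof (induction e)
  case 0
  then show ?case using homogeneous_one by (simp add: zero_fun_def)
next
  case (Suc e)
  have "(\<lambda>k. int (Suc e) * \<alpha> k) = \<alpha> + (\<lambda>k. int e * \<alpha> k)" by (auto simp: algebra_simps)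
  then show ?case using homogeneous_mult[OF assms Suc] by simp
qed

text \<open>A nonconstant \<open>f\<close> of weight 0 and \<open>n\<close> elements of independent
  weights would give \<open>n + 1\<close> algebraically independent functions, too many for
  polynomial growth of degree \<open>n\<close>. A relation found by counting splits by weight into
  polynomial relations for \<open>f\<close> alone.\<close>

lemma invariant_const:
  assumes f: "homogeneous 0 f"
  shows "ev a f = ev b f"
proof (rule ccontr)
  assume nonconst: "ev a f \<noteq> ev b f"
  obtain \<alpha> :: "'n \<Rightarrow> 'n \<Rightarrow> int" where \<alpha>: "\<And>i. \<alpha> i \<in> point_weights"
    and indep: "\<And>b. (\<And>j. (\<Sum>i\<in>UNIV. b i * \<alpha> i j) = 0) \<Longrightarrow> b = 0"
    using ex_independent_integer_family[of point_weights] point_weights_not_orthogonal[OF effective]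
    by metis
  obtain g where g: "\<And>i. homogeneous (\<alpha> i) (g i)" "\<And>i. \<not> vanishing (g i)"
    using \<alpha> unfolding point_weights_def by simp metis
  have "\<exists>mg. \<forall>i. length_bounded (mg i) (g i)" by (intro choice allI ex_length_bounded)
  then obtain mg where mg: "\<And>i. length_bounded (mg i) (g i)" by blast
  obtain mf where mf: "length_bounded mf f" using ex_length_bounded by blast
  define D where "D = mf + sum mg UNIV"
  have D: "length_bounded D f" "length_bounded D (g i)" for i
  proof -
    show "length_bounded D f" by (rule length_bounded_mono[OF mf]) (simp add: D_def)
    have "mg i \<le> sum mg UNIV" by (rule member_le_sum) simp_all
    then show "length_bounded D (g i)" by (intro length_bounded_mono[OF mg]) (simp add: D_def)
  qed
  \<comment> \<open>An enumeration of the generators fixes the order of factors in a noncommutative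
    product.\<close>
  obtain xs :: "'n list" where xs: "set xs = UNIV" "distinct xs"
    using finite_distinct_list[of "UNIV :: 'n set"] by auto
  have len: "length xs = CARD('n)" using distinct_card[OF xs(2)] xs(1) by simp
  define C where "C = Suc CARD('n) * D"
  \<comment> \<open>This makes (C + 1)^n equal to \<open>N\<close>, so (N C + 1)^n is at most (N +
    1)^n N, strictly below the number (N + 1)^(n + 1) of products.\<close>
  define N where "N = (C + 1) ^ CARD('n)"
  define G where "G e = prod_list (map (\<lambda>i. g i ^ e i) xs)" for e :: "'n \<Rightarrow> nat"
  define E :: "('n \<Rightarrow> nat) set" where "E = PiE UNIV (\<lambda>_. {..N})"
  define wt where "wt e = sum_list (map (\<lambda>i k. int (e i) * \<alpha> i k) xs)" for e :: "'n \<Rightarrow> nat"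
  have G: "homogeneous (wt e) (G e)" "\<not> vanishing (G e)" for e
    unfolding wt_def G_def
    by (rule homogeneous_prod_list[OF homogeneous_power[OF g(1)]],
        rule not_vanishing_prod_list) (auto simp: not_vanishing_power[OF g(2)])
  have wt: "wt e j = (\<Sum>i\<in>UNIV. int (e i) * \<alpha> i j)" for e j
    by (simp only: wt_def sum_list_fun_apply)
      (simp only: sum_list_distinct_conv_sum_set[OF xs(2)] xs(1))
  have inj: "inj_on wt E"
  proof (rule inj_onI)
    fix e e' assume "wt e = wt e'"
    then have "(\<Sum>i\<in>UNIV. (int (e i) - int (e' i)) * \<alpha> i j) = 0" for j
      using wt[of e j] wt[of e' j] by (simp add: left_diff_distrib sum_subtractf)
    then have "(\<lambda>i. int (e i) - int (e' i)) = 0" by (rule indep)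
    then show "e = e'" by (simp add: fun_eq_iff)
  qed
  define h where "h = (\<lambda>(e, j). f ^ j * G e)"
  have fin: "finite E" by (simp add: E_def finite_PiE)
  have "length_bounded (N * C) (h x)" if "x \<in> E \<times> {..N}" for x
  proof -
    obtain e j where x: "x = (e, j)" by (cases x)
    have le: "j \<le> N" "e i \<le> N" for i
      using that by (simp_all add: x E_def PiE_iff)
    have "length_bounded (N * D) (f ^ j)"
      by (rule length_bounded_mono[OF length_bounded_power[OF D(1)]]) (simp add: le)
    moreover have "length_bounded (length xs * (N * D)) (G e)"
    proof -
      have "length_bounded (N * D) (g i ^ e i)" for i
        by (rule length_bounded_mono[OF length_bounded_power[OF D(2)]]) (simp add: le)
      then show ?thesis
        unfolding G_def using length_bounded_prod_list[of "map (\<lambda>i. g i ^ e i) xs" "N * D"] by auto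
    qed
    ultimately have "length_bounded (N * D + length xs * (N * D)) (h x)"
      unfolding h_def x prod.case by (rule length_bounded_mult)
    then show ?thesis by (simp add: len C_def algebra_simps)
  qed
  moreover have "(N * C + 1) ^ CARD('n) < card (E \<times> {..N})"
  proof -
    have "(N * C + 1) ^ CARD('n) \<le> ((N + 1) * (C + 1)) ^ CARD('n)"
      by (intro power_mono) simp_all
    also have "\<dots> = (N + 1) ^ CARD('n) * N" by (simp only: power_mult_distrib N_def)
    also have "\<dots> < (N + 1) ^ CARD('n) * (N + 1)" by simp
    also have "\<dots> = card (E \<times> {..N})"
      by (simp add: E_def card_cartesian_product card_PiE)
    finally show ?thesis .
  qed
  ultimately obtain c where c: "\<exists>x\<in>E \<times> {..N}. c x \<noteq> 0"
    "vanishing (\<Sum>x\<in>E \<times> {..N}. free_scale (c x) (h x))"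
    using ex_relation_on_points[of "E \<times> {..N}" "N * C" h] fin by auto
  \<comment> \<open>Grouping by \<open>e\<close> leaves a polynomial in \<open>f\<close>, of weight
    0, times \<open>G e\<close>; distinct \<open>e\<close> give distinct weights.\<close>
  define y where "y e = (\<Sum>j\<le>N. free_scale (c (e, j)) (f ^ j))" for e
  have "(\<Sum>x\<in>E \<times> {..N}. free_scale (c x) (h x)) = (\<Sum>e\<in>E. y e * G e)"
    by (simp add: sum.cartesian_product y_def h_def sum_distrib_right
        free_algebra.scale_mult_left case_prod_unfold)
  with c(2) have sum: "vanishing (\<Sum>e\<in>E. y e * G e)" by simp
  have "homogeneous (0 + wt e) (y e * G e)" for e
  proof (rule homogeneous_mult[OF _ G(1)])
    have "homogeneous 0 (f ^ j)" for j
      using homogeneous_power[OF f, of j] by (simp add: zero_fun_def)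
    then show "homogeneous 0 (y e)"
      unfolding y_def by (intro homogeneous_sum homogeneous_scale)
  qed
  then have hom: "homogeneous (wt e) (y e * G e)" for e by simp
  obtain e j where ej: "e \<in> E" "j \<le> N" "c (e, j) \<noteq> 0" using c(1) by blast
  have "vanishing (y e * G e)"
    by (rule vanishing_homogeneous_summand[OF fin inj hom sum ej(1)])
  then have "vanishing (y e)" using vanishing_mult_cancel G(2) by blast
  then show False
    using vanishing_polynomial_relation[OF nonconst _ ej(2), of "\<lambda>j. c (e, j)"] ej(3)
    unfolding y_def by simp
qed

text \<open>The product has weight 0, hence is constant on points. A nonzero constant would make
  \<open>u\<close> a unit on points, hence constant, although its weight is nonzero.\<close>

lemma vanishing_opposite_weights:
  assumes u: "homogeneous \<beta> u" and v: "homogeneous \<gamma> v" and "\<beta> + \<gamma> = 0" "\<beta> \<noteq> 0"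
  shows "vanishing (u * v)"
proof (rule ccontr)
  assume nonzero: "\<not> vanishing (u * v)"
  define c where "c = ev 0 (u * v)"
  have c: "ev x (u * v) = c" for x
    unfolding c_def by (rule invariant_const) (use homogeneous_mult[OF u v] assms(3) in simp)
  with nonzero have "c \<noteq> 0" by (auto simp: vanishing_def)
  then have const: "ev x u = ev 0 u" for x using ev_const_if_unit c by blast
  define m where "m = - ev 0 u"
  \<comment> \<open>The sum of \<open>u\<close> and minus its constant value vanishes at every
    point; separating weights 0 and \<open>\<beta>\<close> forces \<open>u\<close> itself to vanish
    there.\<close>
  define x where "x \<alpha> = (if \<alpha> = 0 then free_scale m 1 else u)" for \<alpha> :: "'n \<Rightarrow> int"
  have "vanishing (x \<beta>)"
  proof (rule vanishing_homogeneous_summand[where wt = id and I = "{0, \<beta>}"])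
    show "homogeneous (id \<alpha>) (x \<alpha>)" if "\<alpha> \<in> {0, \<beta>}" for \<alpha>
      using that u homogeneous_scale[OF homogeneous_one] by (auto simp: x_def)
    show "vanishing (\<Sum>\<alpha>\<in>{0, \<beta>}. x \<alpha>)"
      unfolding vanishing_def
    proof
      fix z
      show "ev z (\<Sum>\<alpha>\<in>{0, \<beta>}. x \<alpha>) = 0"
        using \<open>\<beta> \<noteq> 0\<close> const[of z] by (simp add: x_def m_def ev.diff ev.scale ev.hom_one)
    qed
  qed auto
  with nonzero \<open>\<beta> \<noteq> 0\<close> show False by (simp add: x_def vanishing_def ev.hom_mult)
qed

text \<open>For \<open>\<beta> = 0\<close> one factor is zero by assumption; all other contributions
  are products of opposite nonzero weights.\<close>

lemma vanishing_component_0_mult: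
  assumes "component 0 x = 0 \<or> component 0 y = 0"
  shows "vanishing (component 0 (x * y))"
proof -
  have "component 0 (x * y) \<in> {f. vanishing f}"
  proof (rule p_mult_in_subspace[OF subspace_vanishing])
    fix \<beta> \<gamma> :: "'n \<Rightarrow> int" assume "0 = \<beta> + \<gamma>"
    then show "component \<beta> x * component \<gamma> y \<in> {f. vanishing f}"
      using assms vanishing_opposite_weights[OF homogeneous_p homogeneous_p, of \<beta> \<gamma> x y]
      by (cases "\<beta> = 0") (auto simp: vanishing_def ev.zero)
  qed
  then show ?thesis by simp
qed

text \<open>Multiplicativity follows by splitting off the weight-zero parts: all mixed terms
  contribute 0. Evaluating at the origin is no real choice, as elements of weight 0 are constant on
  points.\<close>

lemma algebra_hom_ev_component_0: "algebra_hom free_scale (*) (\<lambda>f. ev 0 (component 0 f))"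
proof (rule algebra_homI)
  fix x y
  define x0 y0 where "x0 = component 0 x" and "y0 = component 0 y"
  have hom: "homogeneous 0 x0" "homogeneous 0 y0" by (simp_all add: x0_def y0_def)
  have c0: "component 0 x0 = x0" "component 0 y0 = y0"
    using hom by (simp_all add: homogeneous_def)
  have c1: "component 0 (x - x0) = 0" "component 0 (y - y0) = 0"
    by (simp_all add: p.diff c0) (simp_all add: x0_def y0_def)
  have "homogeneous 0 (x0 * y0)" using homogeneous_mult[OF hom] by simp
  then have "component 0 (x0 * y0) = x0 * y0" by (simp add: homogeneous_def)
  moreover have "component 0 (x * y) =
      component 0 (x0 * y0) + component 0 (x0 * (y - y0)) + component 0 ((x - x0) * y)"
    by (simp add: algebra_simps flip: p.add)
  moreover have "ev 0 (component 0 (x0 * (y - y0))) = 0" "ev 0 (component 0 ((x - x0) * y)) = 0"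
    using vanishing_component_0_mult c1 unfolding vanishing_def by blast+
  ultimately show "ev 0 (component 0 (x * y)) = ev 0 (component 0 x) * ev 0 (component 0 y)"
    by (simp add: ev.add ev.hom_mult x0_def y0_def)
next
  fix x y c
  show "ev 0 (component 0 (x + y)) = ev 0 (component 0 x) + ev 0 (component 0 y)"
    by (simp add: p_add ev.add)
  show "ev 0 (component 0 (free_scale c x)) = c * ev 0 (component 0 x)"
    by (simp only: p_scale ev.scale)
  show "ev 0 (component 0 1) = 1"
    by (simp add: p_one ev.hom_one)
qed (fact free_algebra.assoc_algebra_axioms field_algebra.assoc_algebra_axioms)+

text \<open>The value of \<open>f\<close> at this point is that of its weight-zero component.
  Components of nonzero weight therefore vanish there, and the one of weight 0 has the same value as
  \<open>f\<close>.\<close>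

lemma ex_fixed_point: "\<exists>b. \<forall>f \<alpha>. ev b f = 0 \<longrightarrow> ev b (component \<alpha> f) = 0"
proof -
  obtain b where b: "(\<lambda>f. ev 0 (component 0 f)) = ev b"
    using algebra_hom_eq_ev[OF algebra_hom_ev_component_0] by blast
  have "ev b (component \<alpha> f) = 0" if f: "ev b f = 0" for \<alpha> f
    using f fun_cong[OF b, of "component \<alpha> f"] fun_cong[OF b, of f]
    by (auto simp: component_component ev.zero split: if_splits)
  then show ?thesis by blast
qed

text \<open>A vector orthogonal to all \<open>d i\<close> is orthogonal to every weight, hence zero
  by effectiveness. So the rows \<open>d i\<close> are independent, and a weight determines how
  often each generator occurs.\<close>

lemma length_determined_by_weight:
  fixes d :: "'n \<Rightarrow> 'n \<Rightarrow> int"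
  assumes d: "\<And>\<alpha> x. component \<alpha> x \<noteq> 0 \<Longrightarrow> \<exists>w. sum_list (map d w) = \<alpha>"
    and vw: "sum_list (map d v) = sum_list (map d w)"
  shows "length v = length w"
proof -
  have "(\<lambda>i. int (count_list v i) - int (count_list w i)) = 0"
  proof (rule int_square_rows_independent)
    fix l assume l: "\<And>i. (\<Sum>j\<in>UNIV. l j * d i j) = 0"
    show "l = 0"
    proof (rule point_weights_not_orthogonal[OF effective])
      fix \<alpha> assume "\<alpha> \<in> point_weights"
      then obtain f a where "component \<alpha> f = f" "ev a f \<noteq> 0"
        by (auto simp: point_weights_def homogeneous_def vanishing_def)
      then have "component \<alpha> f \<noteq> 0" by (auto simp: ev.zero)
      then obtain u where "sum_list (map d u) = \<alpha>" using d by blast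
      moreover have "(\<Sum>j\<in>UNIV. l j * sum_list (map d u) j) = 0"
        by (induction u) (simp_all add: distrib_left sum.distrib l)
      ultimately show "(\<Sum>j\<in>UNIV. l j * \<alpha> j) = 0" by simp
    qed
  next
    fix j
    show "(\<Sum>i\<in>UNIV. (int (count_list v i) - int (count_list w i)) * d i j) = 0"
      using fun_cong[OF vw, of j]
      by (simp add: sum_list_fun_apply sum_list_map_eq_sum_count_int left_diff_distrib sum_subtractf)
  qed
  then have count: "count_list v i = count_list w i" for i by (simp add: fun_eq_iff)
  have "int (length u) = (\<Sum>i\<in>UNIV. int (count_list u i))" for u :: "'n list"
    using sum_list_map_eq_sum_count_int[of "\<lambda>_. 1" u] by (simp add: sum_list_triv)
  from this[of v] this[of w] have "int (length v) = int (length w)" by (simp only: count)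
  then show ?thesis by simp
qed

lemma ex_homogeneous_generators:
  "\<exists>\<beta> d. algebra_automorphism free_scale \<beta> \<and> (\<forall>i. homogeneous (d i) (\<beta> (gen i)))"
proof -
  obtain b where b: "\<And>f \<alpha>. ev b f = 0 \<Longrightarrow> ev b (component \<alpha> f) = 0"
    using ex_fixed_point by blast
  \<comment> \<open>Translation by \<open>s\<close> times the fixed point; the parameter covers the
    translation and its inverse together.\<close>
  define T :: "'k \<Rightarrow> ('n, 'k) free_algebra \<Rightarrow> ('n, 'k) free_algebra" where "T s = free_lift free_scale (\<lambda>i. gen i + free_scale (s * b i) 1)" for s
  interpret T: algebra_hom free_scale free_scale "T s" for s
    unfolding T_def by (rule free_algebra.algebra_hom_free_lift)
  have T_gen: "T s (gen i) = gen i + free_scale (s * b i) 1" for s i by (simp add: T_def)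
  have TT: "T s \<circ> T r = id" if "s + r = 0" for s r
    by (rule free_algebra_hom_eqI[OF algebra_hom_comp[OF T.algebra_hom_axioms T.algebra_hom_axioms]
          free_algebra.algebra_hom_id])
      (use that in \<open>simp add: T_gen T.add T.scale T.hom_one add.assoc
        free_algebra.scale_left_distrib[symmetric] distrib_right[symmetric]\<close>)
  have T_T: "T 1 (T (- 1) f) = f" "T (- 1) (T 1 f) = f" for f
    using TT[of 1 "- 1"] TT[of "- 1" 1] by (simp_all add: fun_eq_iff)
  have inv: "inv (T 1) = T (- 1)" using TT[of 1 "- 1"] TT[of "- 1" 1] by (simp add: inv_unique_comp)
  have "ev (\<lambda>_. 0) \<circ> T 1 = ev b"
    by (rule free_algebra_hom_eqI[OF algebra_hom_comp[OF T.algebra_hom_axioms ev.algebra_hom_axioms]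
          ev.algebra_hom_axioms])
      (simp add: T_gen ev.add ev.scale ev.hom_one)
  then have ev_T: "ev (\<lambda>_. 0) (T 1 f) = ev b f" for f by (metis comp_apply)
  \<comment> \<open>In the translated grading the fixed point is the origin, as \<open>ev_T\<close>
    shows.\<close>
  define q where "q = (\<lambda>\<alpha>. T 1 \<circ> component \<alpha> \<circ> T (- 1))"
  have aut: "algebra_automorphism free_scale (T s)" if "s + r = 0" for s r
    by (rule algebra_automorphism_inverse[OF T.algebra_hom_axioms T.algebra_hom_axioms[of r]])
      (use that in \<open>simp_all add: TT add.commute\<close>)
  interpret q: algebra_grading free_scale q
    using grading_transport[OF aut[of 1 "- 1"]] by (simp add: q_def inv)
  have q: "augmented_grading q"
  proof
    fix f :: "('n, 'k) free_algebra" and \<alpha> assume "f \<in> aug (Suc 0)"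
    then have "ev b (T (- 1) f) = 0"
      by (simp add: in_aug_iff_Nil lookup_Nil_eq_ev T_T flip: ev_T)
    then show "q \<alpha> f \<in> aug (Suc 0)"
      by (simp add: in_aug_iff_Nil lookup_Nil_eq_ev q_def ev_T b)
  qed
  have "\<exists>\<beta> d. algebra_automorphism free_scale \<beta> \<and> (\<forall>i. q (d i) (\<beta> (gen i)) = \<beta> (gen i))"
  proof (rule augmented_grading_linearizable[OF q])
    fix d :: "'n \<Rightarrow> 'n \<Rightarrow> int" and v w
    assume d: "\<And>\<alpha> x. q \<alpha> x \<noteq> 0 \<Longrightarrow> \<exists>w. sum_list (map d w) = \<alpha>"
      and vw: "sum_list (map d v) = sum_list (map d w)"
    have "\<exists>w. sum_list (map d w) = \<alpha>" if "component \<alpha> x \<noteq> 0" for \<alpha> x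
    proof (rule d[of _ "T 1 x"])
      have "T (- 1) (q \<alpha> (T 1 x)) \<noteq> T (- 1) 0" using that by (simp add: q_def T_T T.zero)
      then show "q \<alpha> (T 1 x) \<noteq> 0" by metis
    qed
    then show "length v = length w" using length_determined_by_weight vw by blast
  qed
  then obtain \<beta> d where \<beta>: "algebra_automorphism free_scale \<beta>"
    and d: "\<And>i. q (d i) (\<beta> (gen i)) = \<beta> (gen i)" by blast
  have "algebra_automorphism free_scale (T (- 1) \<circ> \<beta>)"
    using \<beta> aut[of "- 1" 1] unfolding algebra_automorphism_def
    by (auto intro: algebra_hom_comp bij_comp)
  moreover have "homogeneous (d i) ((T (- 1) \<circ> \<beta>) (gen i))" for i
    using arg_cong[OF d[of i], of "T (- 1)"] by (simp add: homogeneous_def q_def T_T)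
  ultimately show ?thesis by blast
qed

end

theorem theorem1p1:
  fixes \<sigma> :: "('n::finite, 'k::alg_closed_field) free_algebra
                 \<Rightarrow> ('n, ('n, 'k) free_algebra) laurent"
  assumes "regular_action free_scale \<sigma>"
    and "effective free_scale \<sigma>"
  shows "linearizable \<sigma>"
proof -
  interpret maximal_torus_action \<sigma> by standard (fact assms)+
  obtain \<beta> d where \<beta>: "algebra_automorphism free_scale \<beta>"
    and d: "\<And>i. homogeneous (d i) (\<beta> (gen i))"
    using ex_homogeneous_generators by blast
  interpret \<beta>: algebra_hom free_scale free_scale \<beta>
    using \<beta> by (simp add: algebra_automorphism_def)
  have "inj \<beta>" using \<beta> by (simp add: algebra_automorphism_def bij_is_inj)
  \<comment> \<open>In the homogeneous coordinates the action is even diagonal, with the characters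
    \<open>d i\<close>.\<close>
  have "(inv \<beta> \<circ> act t \<circ> \<beta>) (gen i) = free_scale (torus_character (d i) t) (gen i)"
    if t: "t \<in> torus" for t i
  proof -
    have "act t (\<beta> (gen i)) = \<beta> (free_scale (torus_character (d i) t) (gen i))"
      by (simp add: act_homogeneous[OF t d] \<beta>.scale)
    then show ?thesis using \<open>inj \<beta>\<close> by simp
  qed
  then have "linear_family (\<lambda>t. inv \<beta> \<circ> act t \<circ> \<beta>)"
    by (auto simp: linear_family_def intro: free_algebra.span_scale free_algebra.span_base)
  with \<beta> show ?thesis unfolding linearizable_def by blast
qed

end
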